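(* Let $G$ be a cyclic group of order $m=4$ with generator $t$, let $L=\mathbb{Z}^6$, and let $\rho\colon G\to\mathrm{aut}_{\mathbb{Z}}(L)$ be the homomorphism for which $t$ acts on $L$ by the matrix $$\begin{pmatrix}0&1&0&0&0&0\\-1&0&1&0&0&0\\0&0&1&0&0&0\\0&0&0&1&0&0\\0&0&0&-1&0&1\\0&0&0&0&-1&0\end{pmatrix}.$$ Then the second differential in the Lyndon-Hochschild-Serre spectral sequence $E_2^{i,j}=H^i(G;H^j(L))\Rightarrow H^{i+j}(L\rtimes_\rho G;\mathbb{Z})$ associated to the semi-direct product $L\rtimes_\rho G$ is non-trivial. In particular, it is not true that for every finite cyclic group $G$, every finitely generated free abelian group $L$ and every homomorphism $\rho\colon G\to\mathrm{aut}_{\mathbb{Z}}(L)$ the Lyndon-Hochschild-Serre spectral sequence associated to $L\rtimes_\rho G$ collapses in the strongest sense.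
   Context: $H^j(L)=H^j(L;\mathbb{Z})$ with its induced $G$-action. The second differential consists of the maps $d_2\colon E_2^{i,j}\to E_2^{i+2,j-1}$; it is non-trivial if at least one of them is non-zero. "Collapses in the strongest sense" means that all differentials in the $E_r$-terms for $r\ge 2$ are trivial and all extension problems at the $E_\infty$-level are trivial (the exact sequences of abelian groups describing the filtration of $H^k(L\rtimes_\rho G;\mathbb{Z})$ with quotients $E_\infty^{i,k-i}$ all split). Matrices act on column vectors. *)

theory Defs
  imports "HOL-Algebra.Algebra" "Jordan_Normal_Form.Matrix"
begin

section \<open>Integral cochains of a group\<close>

text \<open>
  The normalized inhomogeneous (bar) cochain complex of a group \<open>\<Gamma>\<close> with coefficients in the
  trivial module of integers. An \<open>n\<close>-cochain is a function of \<open>n\<close> group elements, encoded as a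
  function on lists that is zero on all lists which are not lists of \<open>n\<close> elements of \<open>\<Gamma>\<close>;
  normalized means that it also vanishes as soon as one argument is the unit. Degrees are
  integers, and there is only the zero cochain in negative degrees.
\<close>

definition cochains :: "'a monoid \<Rightarrow> int \<Rightarrow> ('a list \<Rightarrow> int) set" where
  "cochains \<Gamma> n = {f. \<forall>xs. f xs \<noteq> 0 \<longrightarrow>
      int (length xs) = n \<and> set xs \<subseteq> carrier \<Gamma> \<and> \<one>\<^bsub>\<Gamma>\<^esub> \<notin> set xs}"

definition cochain_group :: "'a monoid \<Rightarrow> int \<Rightarrow> ('a list \<Rightarrow> int) monoid" where
  "cochain_group \<Gamma> n =
     \<lparr>carrier = cochains \<Gamma> n, monoid.mult = (\<lambda>f g xs. f xs + g xs), one = (\<lambda>xs. 0)\<rparr>"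

text \<open>
  For an \<open>n\<close>-cochain \<open>f\<close> this is the usual formula
  \[ (\delta f)(x_1,\dots,x_{n+1}) = f(x_2,\dots,x_{n+1})
     + \sum_{i=1}^{n} (-1)^i f(x_1,\dots,x_i x_{i+1},\dots,x_{n+1})
     + (-1)^{n+1} f(x_1,\dots,x_n); \]
  the list is indexed from 0, so the \<open>i\<close>-th summand below is the one with number \<open>i + 1\<close>.
\<close>

definition coboundary :: "'a monoid \<Rightarrow> ('a list \<Rightarrow> int) \<Rightarrow> ('a list \<Rightarrow> int)" where
  "coboundary \<Gamma> f = (\<lambda>xs.
     if xs \<noteq> [] \<and> set xs \<subseteq> carrier \<Gamma> then
       f (tl xs)
       + (\<Sum>i<length xs - 1. (-1) ^ (i + 1) *
            f (take i xs @ (xs ! i \<otimes>\<^bsub>\<Gamma>\<^esub> xs ! (i + 1)) # drop (i + 2) xs))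
       + (-1) ^ length xs * f (butlast xs)
     else 0)"

definition cocycles :: "'a monoid \<Rightarrow> int \<Rightarrow> ('a list \<Rightarrow> int) set" where
  "cocycles \<Gamma> n = {f \<in> cochains \<Gamma> n. coboundary \<Gamma> f = (\<lambda>xs. 0)}"

definition coboundaries :: "'a monoid \<Rightarrow> int \<Rightarrow> ('a list \<Rightarrow> int) set" where
  "coboundaries \<Gamma> n = coboundary \<Gamma> ` cochains \<Gamma> (n - 1)"

definition group_cohomology :: "'a monoid \<Rightarrow> int \<Rightarrow> ('a list \<Rightarrow> int) set monoid" where
  "group_cohomology \<Gamma> n =
     (cochain_group \<Gamma> n)\<lparr>carrier := cocycles \<Gamma> n\<rparr> Mod coboundaries \<Gamma> n"

section \<open>The Lyndon-Hochschild-Serre spectral sequence\<close>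

text \<open>
  Let \<open>N\<close> be a normal subgroup of \<open>\<Gamma>\<close>. Following Hochschild and Serre (Cohomology of group
  extensions, Trans. Amer. Math. Soc. 74, 1953, Chapter II), the spectral sequence of the
  extension is the one of the cochain complex of \<open>\<Gamma>\<close> with the following decreasing filtration
  by subcomplexes: for \<open>p \<le> n\<close>, the \<open>p\<close>-th step in degree \<open>n\<close> consists of the normalized cochains
  \<open>f(x\<^sub>1,\<dots>,x\<^sub>n)\<close> that depend only on \<open>x\<^sub>1,\<dots>,x\<^bsub>n-p\<^esub>\<close> and on the cosets of
  \<open>x\<^bsub>n-p+1\<^esub>,\<dots>,x\<^sub>n\<close> modulo \<open>N\<close>; for \<open>p > n\<close> it is zero. For \<open>p \<le> 0\<close> it is the group of all
  cochains. Hochschild and Serre show that the second page is \<open>H\<^sup>p(\<Gamma>/N; H\<^sup>q(N))\<close>, with the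
  action of \<open>\<Gamma>/N\<close> on \<open>H\<^sup>q(N)\<close> induced by conjugation.
\<close>

definition lhs_filtration ::
    "'a monoid \<Rightarrow> 'a set \<Rightarrow> int \<Rightarrow> int \<Rightarrow> ('a list \<Rightarrow> int) set" where
  "lhs_filtration \<Gamma> N p n =
     (if n < p then {\<lambda>xs. 0}
      else {f \<in> cochains \<Gamma> n. \<forall>xs ys.
              int (length xs) = n \<and> int (length ys) = n \<and>
              set xs \<subseteq> carrier \<Gamma> \<and> set ys \<subseteq> carrier \<Gamma> \<and>
              take (nat (n - p)) xs = take (nat (n - p)) ys \<and>
              list_all2 (\<lambda>x y. x <#\<^bsub>\<Gamma>\<^esub> N = y <#\<^bsub>\<Gamma>\<^esub> N)
                (drop (nat (n - p)) xs) (drop (nat (n - p)) ys)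
              \<longrightarrow> f xs = f ys})"

text \<open>
  The pages are those of the spectral sequence of a filtered complex: with
  \<open>Z\<^sub>r\<^sup>p\<^sup>q = {f \<in> F\<^sup>p C\<^sup>p\<^sup>+\<^sup>q. \<delta> f \<in> F\<^sup>p\<^sup>+\<^sup>r}\<close>, the group \<open>E\<^sub>r\<^sup>p\<^sup>q\<close> is \<open>Z\<^sub>r\<^sup>p\<^sup>q\<close> modulo
  \<open>B\<^sub>r\<^sup>p\<^sup>q = Z\<close> (at \<open>r - 1\<close>, \<open>p + 1\<close>, \<open>q - 1\<close>) \<open>+ \<delta> Z\<close> (at \<open>r - 1\<close>, \<open>p - r + 1\<close>, \<open>q + r - 2\<close>).
  The differential \<open>d\<^sub>r\<close> sends the class of \<open>f\<close> to the class of \<open>\<delta> f\<close>.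
\<close>

definition lhs_Z :: "'a monoid \<Rightarrow> 'a set \<Rightarrow> int \<Rightarrow> int \<Rightarrow> int \<Rightarrow> ('a list \<Rightarrow> int) set" where
  "lhs_Z \<Gamma> N r p q =
     {f \<in> lhs_filtration \<Gamma> N p (p + q).
        coboundary \<Gamma> f \<in> lhs_filtration \<Gamma> N (p + r) (p + q + 1)}"

definition lhs_B :: "'a monoid \<Rightarrow> 'a set \<Rightarrow> int \<Rightarrow> int \<Rightarrow> int \<Rightarrow> ('a list \<Rightarrow> int) set" where
  "lhs_B \<Gamma> N r p q =
     lhs_Z \<Gamma> N (r - 1) (p + 1) (q - 1)
       <#>\<^bsub>cochain_group \<Gamma> (p + q)\<^esub>
     coboundary \<Gamma> ` lhs_Z \<Gamma> N (r - 1) (p - r + 1) (q + r - 2)"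

definition lhs_E ::
    "'a monoid \<Rightarrow> 'a set \<Rightarrow> int \<Rightarrow> int \<Rightarrow> int \<Rightarrow> ('a list \<Rightarrow> int) set monoid" where
  "lhs_E \<Gamma> N r p q =
     (cochain_group \<Gamma> (p + q))\<lparr>carrier := lhs_Z \<Gamma> N r p q\<rparr> Mod lhs_B \<Gamma> N r p q"

text \<open>As a coset, the value of \<open>d\<^sub>r\<close> on the coset \<open>K\<close> is \<open>B\<^sub>r + \<delta> K\<close>.\<close>

definition lhs_d ::
    "'a monoid \<Rightarrow> 'a set \<Rightarrow> int \<Rightarrow> int \<Rightarrow> int \<Rightarrow> ('a list \<Rightarrow> int) set \<Rightarrow> ('a list \<Rightarrow> int) set" where
  "lhs_d \<Gamma> N r p q K =
     lhs_B \<Gamma> N r (p + r) (q - r + 1) <#>\<^bsub>cochain_group \<Gamma> (p + q + 1)\<^esub> coboundary \<Gamma> ` K"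

definition lhs_differential_trivial :: "'a monoid \<Rightarrow> 'a set \<Rightarrow> int \<Rightarrow> bool" where
  "lhs_differential_trivial \<Gamma> N r \<longleftrightarrow>
     (\<forall>p q. \<forall>K \<in> carrier (lhs_E \<Gamma> N r p q).
        lhs_d \<Gamma> N r p q K = \<one>\<^bsub>lhs_E \<Gamma> N r (p + r) (q - r + 1)\<^esub>)"

subsection \<open>The limit page and the extension problems\<close>

definition lhs_Z_inf :: "'a monoid \<Rightarrow> 'a set \<Rightarrow> int \<Rightarrow> int \<Rightarrow> ('a list \<Rightarrow> int) set" where
  "lhs_Z_inf \<Gamma> N p q = lhs_filtration \<Gamma> N p (p + q) \<inter> cocycles \<Gamma> (p + q)"

definition lhs_B_inf :: "'a monoid \<Rightarrow> 'a set \<Rightarrow> int \<Rightarrow> int \<Rightarrow> ('a list \<Rightarrow> int) set" where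
  "lhs_B_inf \<Gamma> N p q =
     lhs_Z_inf \<Gamma> N (p + 1) (q - 1)
       <#>\<^bsub>cochain_group \<Gamma> (p + q)\<^esub>
     (lhs_filtration \<Gamma> N p (p + q) \<inter> coboundaries \<Gamma> (p + q))"

definition lhs_E_inf ::
    "'a monoid \<Rightarrow> 'a set \<Rightarrow> int \<Rightarrow> int \<Rightarrow> ('a list \<Rightarrow> int) set monoid" where
  "lhs_E_inf \<Gamma> N p q =
     (cochain_group \<Gamma> (p + q))\<lparr>carrier := lhs_Z_inf \<Gamma> N p q\<rparr> Mod lhs_B_inf \<Gamma> N p q"

text \<open>The classes in \<open>H\<^sup>n(\<Gamma>)\<close> that have a representing cocycle in the \<open>p\<close>-th filtration step.\<close>

definition lhs_filtered_cohomology ::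
    "'a monoid \<Rightarrow> 'a set \<Rightarrow> int \<Rightarrow> int \<Rightarrow> ('a list \<Rightarrow> int) set monoid" where
  "lhs_filtered_cohomology \<Gamma> N p n =
     (group_cohomology \<Gamma> n)\<lparr>carrier :=
        {K \<in> carrier (group_cohomology \<Gamma> n). K \<inter> lhs_filtration \<Gamma> N p n \<noteq> {}}\<rparr>"

text \<open>
  The canonical surjection of \<open>F\<^sup>p H\<^sup>p\<^sup>+\<^sup>q(\<Gamma>)\<close> onto \<open>E\<^sub>\<infinity>\<^sup>p\<^sup>q\<close>, whose kernel is the next
  filtration step: a class \<open>K\<close> goes to the class of any representing cocycle that lies in the
  \<open>p\<close>-th filtration step.
\<close>

definition lhs_to_E_inf ::
    "'a monoid \<Rightarrow> 'a set \<Rightarrow> int \<Rightarrow> int \<Rightarrow> ('a list \<Rightarrow> int) set \<Rightarrow> ('a list \<Rightarrow> int) set" where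
  "lhs_to_E_inf \<Gamma> N p q K =
     lhs_B_inf \<Gamma> N p q <#>\<^bsub>cochain_group \<Gamma> (p + q)\<^esub> (K \<inter> lhs_filtration \<Gamma> N p (p + q))"

text \<open>
  The extension of \<open>E\<^sub>\<infinity>\<^sup>p\<^sup>q\<close> by the \<open>(p + 1)\<close>-st filtration step of \<open>H\<^sup>p\<^sup>+\<^sup>q(\<Gamma>)\<close>
  splits, that is, the surjection above has a homomorphic section.
\<close>

definition lhs_extension_trivial :: "'a monoid \<Rightarrow> 'a set \<Rightarrow> int \<Rightarrow> int \<Rightarrow> bool" where
  "lhs_extension_trivial \<Gamma> N p q \<longleftrightarrow>
     (\<exists>s \<in> hom (lhs_E_inf \<Gamma> N p q) (lhs_filtered_cohomology \<Gamma> N p (p + q)).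
        \<forall>K \<in> carrier (lhs_E_inf \<Gamma> N p q). lhs_to_E_inf \<Gamma> N p q (s K) = K)"

definition lhs_collapses_strongly :: "'a monoid \<Rightarrow> 'a set \<Rightarrow> bool" where
  "lhs_collapses_strongly \<Gamma> N \<longleftrightarrow>
     (\<forall>r \<ge> 2. lhs_differential_trivial \<Gamma> N r) \<and> (\<forall>p q. lhs_extension_trivial \<Gamma> N p q)"

section \<open>Semi-direct products\<close>

definition semidirect_product ::
    "'l monoid \<Rightarrow> 'g monoid \<Rightarrow> ('g \<Rightarrow> 'l \<Rightarrow> 'l) \<Rightarrow> ('l \<times> 'g) monoid" where
  "semidirect_product L G \<rho> =
     \<lparr>carrier = carrier L \<times> carrier G,
      monoid.mult = (\<lambda>(v, g) (w, h). (v \<otimes>\<^bsub>L\<^esub> \<rho> g w, g \<otimes>\<^bsub>G\<^esub> h)),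
      one = (\<one>\<^bsub>L\<^esub>, \<one>\<^bsub>G\<^esub>)\<rparr>"

definition semidirect_kernel :: "'l monoid \<Rightarrow> 'g monoid \<Rightarrow> ('l \<times> 'g) set" where
  "semidirect_kernel L G = carrier L \<times> {\<one>\<^bsub>G\<^esub>}"

definition fin_gen_free_abelian :: "'l monoid \<Rightarrow> bool" where
  "fin_gen_free_abelian L \<longleftrightarrow>
     comm_group L \<and> (\<exists>S :: nat set. finite S \<and> L \<cong> free_Abelian_group S)"

definition the_matrix :: "int mat" where
  "the_matrix = mat_of_rows_list 6
     [[ 0,  1,  0,  0,  0,  0],
      [-1,  0,  1,  0,  0,  0],
      [ 0,  0,  1,  0,  0,  0],
      [ 0,  0,  0,  1,  0,  0],
      [ 0,  0,  0, -1,  0,  1],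
      [ 0,  0,  0,  0, -1,  0]]"

end

theory Submission
  imports Defs
begin

text \<open>
  A class with non-zero \<open>d\<^sub>2\<close> lies in \<open>E\<^sub>2\<^sup>0\<^sup>3\<close>. It is represented by a trilinear form
  \<open>\<beta>\<close> on \<open>L\<close> whose alternation is \<open>G\<close>-invariant, while \<open>\<beta>\<close> itself is invariant only up to forms that
  are symmetric in two arguments. These are polarizations of integral quadratic functions \<open>q\<close>.
  If \<open>d\<^sub>2\<close> vanishes on the class, some 3-cochain \<open>u\<close> of the semi-direct product extends \<open>\<beta>\<close> and has
  coboundary in \<open>F\<^sup>3\<close>, hence vanishing on all tuples with an entry from \<open>L\<close> among the last three.
  Shuffling group elements into \<open>L\<close> then shows that the alternations \<open>W\<^sub>g\<close> of the homotopies
  from \<open>\<beta>\<close> to \<open>g\<beta>\<close> form a crossed homomorphism on \<open>G\<close>. Since \<open>t\<close> has finite order, the norm of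
  \<open>W\<^sub>t\<close> is zero. As \<open>W\<^sub>t\<close> differs from the alternation of \<open>q\<close> by a bilinear form, the norm of
  the alternation of \<open>q\<close> is the norm of a bilinear form. For the given matrix this fails modulo 4.
\<close>

section \<open>The second differential as membership in a boundary group\<close>

lemma coboundary_4:
  assumes "a \<in> carrier \<Gamma>" "b \<in> carrier \<Gamma>" "c \<in> carrier \<Gamma>" "d \<in> carrier \<Gamma>"
  shows "coboundary \<Gamma> f [a, b, c, d] =
    f [b, c, d] - f [a \<otimes>\<^bsub>\<Gamma>\<^esub> b, c, d] + f [a, b \<otimes>\<^bsub>\<Gamma>\<^esub> c, d] - f [a, b, c \<otimes>\<^bsub>\<Gamma>\<^esub> d] + f [a, b, c]"
  using assms by (simp add: coboundary_def lessThan_Suc)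

lemma coboundary_eq_0_length:
  assumes "f \<in> cochains \<Gamma> n" and "int (length xs) \<noteq> n + 1"
  shows "coboundary \<Gamma> f xs = 0"
proof (cases "xs = []")
  case False
  have z: "f ys = 0" if "length ys = length xs - 1" for ys
    using assms that False by (cases xs) (auto simp: cochains_def)
  show ?thesis
    unfolding coboundary_def by (auto simp: z intro!: sum.neutral)
qed (simp add: coboundary_def)

lemma cochain_eq_0_one: "\<lbrakk>f \<in> cochains \<Gamma> n; \<one>\<^bsub>\<Gamma>\<^esub> \<in> set xs\<rbrakk> \<Longrightarrow> f xs = 0"
  unfolding cochains_def by blast

lemma add_mem_set_mult_cochains:
  assumes "f \<in> A" "g \<in> B"
  shows "(\<lambda>xs. f xs + g xs) \<in> A <#>\<^bsub>cochain_group \<Gamma> n\<^esub> B"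
  using assms by (auto simp: set_mult_def cochain_group_def)

lemma coboundary_zero [simp]: "coboundary \<Gamma> (\<lambda>xs. 0) = (\<lambda>xs. 0)"
  by (simp add: coboundary_def fun_eq_iff)

lemma zero_mem_lhs_filtration: "(\<lambda>xs. 0) \<in> lhs_filtration \<Gamma> N p n"
  by (simp add: lhs_filtration_def cochains_def)

lemma zero_mem_lhs_Z: "(\<lambda>xs. 0) \<in> lhs_Z \<Gamma> N r p q"
  by (simp add: lhs_Z_def zero_mem_lhs_filtration)

lemma zero_mem_lhs_B: "(\<lambda>xs. 0) \<in> lhs_B \<Gamma> N r p q"
proof -
  have "(\<lambda>xs. 0) \<in> coboundary \<Gamma> ` lhs_Z \<Gamma> N s i j" for s i j
    by (rule image_eqI[where x = "\<lambda>xs. 0"]) (simp_all add: zero_mem_lhs_Z)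
  from add_mem_set_mult_cochains[OF zero_mem_lhs_Z this] show ?thesis
    by (simp add: lhs_B_def)
qed

text \<open>Since \<open>lhs_B\<close> contains zero, \<open>f\<close> lies in its own coset
  \<open>K\<close>, and its coboundary lies in the value of \<open>lhs_d\<close> at
  \<open>K\<close>. Triviality makes this value the unit of the quotient group, which is the
  subgroup \<open>lhs_B\<close> itself. Triviality of the differential enters the proof only through
  this membership.\<close>

lemma coboundary_mem_lhs_B:
  assumes "lhs_differential_trivial \<Gamma> N r" and f: "f \<in> lhs_Z \<Gamma> N r p q"
  shows "coboundary \<Gamma> f \<in> lhs_B \<Gamma> N r (p + r) (q - r + 1)"
proof -
  define K where "K = lhs_B \<Gamma> N r p q #>\<^bsub>(cochain_group \<Gamma> (p + q))\<lparr>carrier := lhs_Z \<Gamma> N r p q\<rparr>\<^esub> f"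
  have "K \<in> carrier (lhs_E \<Gamma> N r p q)"
    using f by (auto simp: K_def lhs_E_def carrier_FactGroup)
  then have "lhs_d \<Gamma> N r p q K = lhs_B \<Gamma> N r (p + r) (q - r + 1)"
    using assms(1) by (simp add: lhs_differential_trivial_def lhs_E_def)
  moreover have "f \<in> K"
    unfolding K_def r_coset_def
    by (rule UN_I[OF zero_mem_lhs_B]) (simp add: cochain_group_def)
  then have "coboundary \<Gamma> f \<in> lhs_d \<Gamma> N r p q K"
    using add_mem_set_mult_cochains[OF zero_mem_lhs_B imageI, of f K "coboundary \<Gamma>"]
    by (simp add: lhs_d_def)
  ultimately show ?thesis by simp
qed

definition biadditive :: "'l monoid \<Rightarrow> ('l \<Rightarrow> 'l \<Rightarrow> int) \<Rightarrow> bool" where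
  "biadditive L b \<longleftrightarrow> (\<forall>x \<in> carrier L. \<forall>y \<in> carrier L. \<forall>z \<in> carrier L.
     b (x \<otimes>\<^bsub>L\<^esub> y) z = b x z + b y z \<and> b z (x \<otimes>\<^bsub>L\<^esub> y) = b z x + b z y)"

text \<open>The cocycle identities at (x, y, z) and (z, x, y) minus the one at (x, z, y) give
  additivity in the first argument, because commutativity of \<open>L\<close> matches the mixed
  terms. Antisymmetry transfers it to the second argument.\<close>

lemma biadditive_alternation_2_cocycle:
  fixes a :: "'l \<Rightarrow> 'l \<Rightarrow> int"
  assumes "comm_group L"
    and cocycle: "\<And>x y z. \<lbrakk>x \<in> carrier L; y \<in> carrier L; z \<in> carrier L\<rbrakk> \<Longrightarrow>
      a y z - a (x \<otimes>\<^bsub>L\<^esub> y) z + a x (y \<otimes>\<^bsub>L\<^esub> z) - a x y = 0"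
  shows "biadditive L (\<lambda>x y. a x y - a y x)"
proof -
  interpret comm_group L by fact
  have add: "a (x \<otimes>\<^bsub>L\<^esub> y) z - a z (x \<otimes>\<^bsub>L\<^esub> y) = (a x z - a z x) + (a y z - a z y)"
    if "x \<in> carrier L" "y \<in> carrier L" "z \<in> carrier L" for x y z
    using cocycle[of x y z] cocycle[of z x y] cocycle[of x z y] that
      m_comm[of z x] m_comm[of z y] by simp
  show ?thesis
    unfolding biadditive_def
  proof (intro ballI conjI)
    fix x y z assume xyz: "x \<in> carrier L" "y \<in> carrier L" "z \<in> carrier L"
    show "a (x \<otimes>\<^bsub>L\<^esub> y) z - a z (x \<otimes>\<^bsub>L\<^esub> y) = (a x z - a z x) + (a y z - a z y)"
      by (rule add[OF xyz])
    show "a z (x \<otimes>\<^bsub>L\<^esub> y) - a (x \<otimes>\<^bsub>L\<^esub> y) z = (a z x - a x z) + (a z y - a y z)"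
      using add[OF xyz] by linarith
  qed
qed

section \<open>The semi-direct product: action, multiplication and cosets of the kernel\<close>

locale semidirect = L: comm_group L + G: group G
  for L :: "'l monoid" and G :: "'g monoid" +
  fixes \<rho> :: "'g \<Rightarrow> 'l \<Rightarrow> 'l"
  assumes action: "\<rho> \<in> hom G (AutoGroup L)"
begin

abbreviation \<Gamma> :: "('l \<times> 'g) monoid" where
  "\<Gamma> \<equiv> semidirect_product L G \<rho>"

abbreviation N :: "('l \<times> 'g) set" where
  "N \<equiv> semidirect_kernel L G"

lemma action_auto: "g \<in> carrier G \<Longrightarrow> \<rho> g \<in> auto L"
  using action by (auto simp: hom_def AutoGroup_def)

lemma action_closed [simp, intro]:
  "\<lbrakk>g \<in> carrier G; x \<in> carrier L\<rbrakk> \<Longrightarrow> \<rho> g x \<in> carrier L"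
  using action_auto by (auto simp: auto_def hom_def)

lemma action_add [simp]:
  "\<lbrakk>g \<in> carrier G; x \<in> carrier L; y \<in> carrier L\<rbrakk> \<Longrightarrow> \<rho> g (x \<otimes>\<^bsub>L\<^esub> y) = \<rho> g x \<otimes>\<^bsub>L\<^esub> \<rho> g y"
  using action_auto by (auto simp: auto_def hom_def)

lemma action_mult:
  assumes "g \<in> carrier G" "h \<in> carrier G" "x \<in> carrier L"
  shows "\<rho> (g \<otimes>\<^bsub>G\<^esub> h) x = \<rho> g (\<rho> h x)"
proof -
  have "\<rho> (g \<otimes>\<^bsub>G\<^esub> h) = \<rho> g \<otimes>\<^bsub>AutoGroup L\<^esub> \<rho> h"
    using action assms by (simp add: hom_mult)
  then show ?thesis
    using action_auto assms by (simp add: AutoGroup_def BijGroup_def auto_def compose_def)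
qed

lemma action_one [simp]: "x \<in> carrier L \<Longrightarrow> \<rho> \<one>\<^bsub>G\<^esub> x = x"
  using hom_one[OF action G.is_group L.AutoGroup] by (simp add: AutoGroup_def BijGroup_def)

lemma action_zero [simp]: "g \<in> carrier G \<Longrightarrow> \<rho> g \<one>\<^bsub>L\<^esub> = \<one>\<^bsub>L\<^esub>"
  using action_auto[of g] hom_one[of "\<rho> g" L L] L.is_group by (auto simp: auto_def)

lemma carrier_semidirect [simp]:
  "(x, g) \<in> carrier \<Gamma> \<longleftrightarrow> x \<in> carrier L \<and> g \<in> carrier G"
  by (simp add: semidirect_product_def)

lemma mult_semidirect [simp]:
  "(x, g) \<otimes>\<^bsub>\<Gamma>\<^esub> (y, h) = (x \<otimes>\<^bsub>L\<^esub> \<rho> g y, g \<otimes>\<^bsub>G\<^esub> h)"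
  by (simp add: semidirect_product_def)

lemma one_semidirect [simp]: "\<one>\<^bsub>\<Gamma>\<^esub> = (\<one>\<^bsub>L\<^esub>, \<one>\<^bsub>G\<^esub>)"
  by (simp add: semidirect_product_def)

lemma coset_kernel:
  assumes "x \<in> carrier L" "g \<in> carrier G"
  shows "(x, g) <#\<^bsub>\<Gamma>\<^esub> N = carrier L \<times> {g}"
proof -
  have "y \<in> (\<lambda>z. x \<otimes>\<^bsub>L\<^esub> \<rho> g z) ` carrier L" if "y \<in> carrier L" for y
  proof (rule image_eqI)
    let ?z = "\<rho> (inv\<^bsub>G\<^esub> g) (inv\<^bsub>L\<^esub> x \<otimes>\<^bsub>L\<^esub> y)"
    show "?z \<in> carrier L" using assms that by (simp del: action_add)
    have "\<rho> g ?z = inv\<^bsub>L\<^esub> x \<otimes>\<^bsub>L\<^esub> y"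
      using assms that by (simp del: action_add flip: action_mult)
    then show "y = x \<otimes>\<^bsub>L\<^esub> \<rho> g ?z"
      using assms that by (simp flip: L.m_assoc)
  qed
  then show ?thesis
    using assms by (fastforce simp: l_coset_def semidirect_kernel_def)
qed

lemma coset_kernel_eq_iff:
  assumes "a \<in> carrier \<Gamma>" "b \<in> carrier \<Gamma>"
  shows "a <#\<^bsub>\<Gamma>\<^esub> N = b <#\<^bsub>\<Gamma>\<^esub> N \<longleftrightarrow> snd a = snd b"
  using assms by (cases a; cases b) (auto simp: coset_kernel)

end

section \<open>Shuffle homotopies in a semi-direct product\<close>

context semidirect
begin

text \<open>The chain homotopy between conjugation by \<open>g\<close> and the identity on the bar complex of \<open>L\<close>.\<close>

definition shuffle :: "('l \<times> 'g \<Rightarrow> 'l \<times> 'g \<Rightarrow> 'l \<times> 'g \<Rightarrow> int) \<Rightarrow> 'g \<Rightarrow> 'l \<Rightarrow> 'l \<Rightarrow> int" where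
  "shuffle u g x y = u (\<one>\<^bsub>L\<^esub>, g) (x, \<one>\<^bsub>G\<^esub>) (y, \<one>\<^bsub>G\<^esub>)
     - u (\<rho> g x, \<one>\<^bsub>G\<^esub>) (\<one>\<^bsub>L\<^esub>, g) (y, \<one>\<^bsub>G\<^esub>)
     + u (\<rho> g x, \<one>\<^bsub>G\<^esub>) (\<rho> g y, \<one>\<^bsub>G\<^esub>) (\<one>\<^bsub>L\<^esub>, g)"

context
  fixes u :: "'l \<times> 'g \<Rightarrow> 'l \<times> 'g \<Rightarrow> 'l \<times> 'g \<Rightarrow> int"
  assumes cocycle: "\<And>a b c d.
      \<lbrakk>a \<in> carrier \<Gamma>; b \<in> carrier \<Gamma>; c \<in> carrier \<Gamma>; d \<in> carrier \<Gamma>; b \<in> N \<or> c \<in> N \<or> d \<in> N\<rbrakk> \<Longrightarrow>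
      u b c d - u (a \<otimes>\<^bsub>\<Gamma>\<^esub> b) c d + u a (b \<otimes>\<^bsub>\<Gamma>\<^esub> c) d - u a b (c \<otimes>\<^bsub>\<Gamma>\<^esub> d) + u a b c = 0"
begin

text \<open>An entry lies in \<open>N\<close> exactly when its \<open>G\<close>-component is the
  unit; in this form the identity can be instantiated at shuffles.\<close>

lemma cocycle_pair:
  assumes "x \<in> carrier L" "y \<in> carrier L" "z \<in> carrier L" "w \<in> carrier L"
    and "a \<in> carrier G" "b \<in> carrier G" "c \<in> carrier G" "d \<in> carrier G"
    and "b = \<one>\<^bsub>G\<^esub> \<or> c = \<one>\<^bsub>G\<^esub> \<or> d = \<one>\<^bsub>G\<^esub>"
  shows "u (y, b) (z, c) (w, d) - u (x \<otimes>\<^bsub>L\<^esub> \<rho> a y, a \<otimes>\<^bsub>G\<^esub> b) (z, c) (w, d)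
    + u (x, a) (y \<otimes>\<^bsub>L\<^esub> \<rho> b z, b \<otimes>\<^bsub>G\<^esub> c) (w, d) - u (x, a) (y, b) (z \<otimes>\<^bsub>L\<^esub> \<rho> c w, c \<otimes>\<^bsub>G\<^esub> d)
    + u (x, a) (y, b) (z, c) = 0"
  using cocycle[of "(x, a)" "(y, b)" "(z, c)" "(w, d)"] assms
  by (auto simp: semidirect_kernel_def)

text \<open>Move \<open>g\<close> through \<open>x\<close>, \<open>y\<close>, \<open>z\<close> from
  left to right, replacing each element it passes by its image under \<open>\<rho> g\<close>. The
  claim is the alternating sum of the cocycle identities at the four resulting tuples: neighbouring
  tuples share the face that multiplies \<open>g\<close> with the element it passes, and these faces
  cancel.\<close>

lemma shuffle_homotopy:
  assumes [simp]: "g \<in> carrier G" "x \<in> carrier L" "y \<in> carrier L" "z \<in> carrier L"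
  shows "shuffle u g y z - shuffle u g (x \<otimes>\<^bsub>L\<^esub> y) z + shuffle u g x (y \<otimes>\<^bsub>L\<^esub> z) - shuffle u g x y
    = u (x, \<one>\<^bsub>G\<^esub>) (y, \<one>\<^bsub>G\<^esub>) (z, \<one>\<^bsub>G\<^esub>)
      - u (\<rho> g x, \<one>\<^bsub>G\<^esub>) (\<rho> g y, \<one>\<^bsub>G\<^esub>) (\<rho> g z, \<one>\<^bsub>G\<^esub>)"
proof -
  note c = cocycle_pair[where a = g and b = "\<one>\<^bsub>G\<^esub>" and c = "\<one>\<^bsub>G\<^esub>" and d = "\<one>\<^bsub>G\<^esub>"
      and x = "\<one>\<^bsub>L\<^esub>" and y = x and z = y and w = z]
    cocycle_pair[where a = "\<one>\<^bsub>G\<^esub>" and b = g and c = "\<one>\<^bsub>G\<^esub>" and d = "\<one>\<^bsub>G\<^esub>"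
      and x = "\<rho> g x" and y = "\<one>\<^bsub>L\<^esub>" and z = y and w = z]
    cocycle_pair[where a = "\<one>\<^bsub>G\<^esub>" and b = "\<one>\<^bsub>G\<^esub>" and c = g and d = "\<one>\<^bsub>G\<^esub>"
      and x = "\<rho> g x" and y = "\<rho> g y" and z = "\<one>\<^bsub>L\<^esub>" and w = z]
    cocycle_pair[where a = "\<one>\<^bsub>G\<^esub>" and b = "\<one>\<^bsub>G\<^esub>" and c = "\<one>\<^bsub>G\<^esub>" and d = g
      and x = "\<rho> g x" and y = "\<rho> g y" and z = "\<rho> g z" and w = "\<one>\<^bsub>L\<^esub>"]
  show ?thesis
    using c by (simp add: shuffle_def)
qed

lemma alternating_shuffle_mult:
  assumes [simp]: "g \<in> carrier G" "h \<in> carrier G" "x \<in> carrier L" "y \<in> carrier L"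
  shows "shuffle u (g \<otimes>\<^bsub>G\<^esub> h) x y - shuffle u (g \<otimes>\<^bsub>G\<^esub> h) y x
    = (shuffle u g (\<rho> h x) (\<rho> h y) - shuffle u g (\<rho> h y) (\<rho> h x))
      + (shuffle u h x y - shuffle u h y x)"
proof -
  \<comment> \<open>The shuffles of \<open>g, h\<close> with two elements of \<open>L\<close> show that \<open>shuffle u\<close> is a crossed
    homomorphism up to the coboundary of \<open>z\<close>, and coboundaries on \<open>L\<close> are symmetric.\<close>
  define z where "z v = u (\<one>\<^bsub>L\<^esub>, g) (\<one>\<^bsub>L\<^esub>, h) (v, \<one>\<^bsub>G\<^esub>)
    - u (\<one>\<^bsub>L\<^esub>, g) (\<rho> h v, \<one>\<^bsub>G\<^esub>) (\<one>\<^bsub>L\<^esub>, h)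
    + u (\<rho> (g \<otimes>\<^bsub>G\<^esub> h) v, \<one>\<^bsub>G\<^esub>) (\<one>\<^bsub>L\<^esub>, g) (\<one>\<^bsub>L\<^esub>, h)" for v
  \<comment> \<open>Of the six shuffles, the one ending in \<open>g\<close>, \<open>h\<close> has
    entries from \<open>L\<close> only in its first two places. Its identity is available for a
    coboundary in F^3, where only the first entry is free, but would not be for one in F^2.\<close>
  have "shuffle u g (\<rho> h x) (\<rho> h y) + shuffle u h x y - shuffle u (g \<otimes>\<^bsub>G\<^esub> h) x y
      = z (x \<otimes>\<^bsub>L\<^esub> y) - z x - z y"
    if [simp]: "x \<in> carrier L" "y \<in> carrier L" for x y
    using cocycle_pair[where a = g and b = h and c = "\<one>\<^bsub>G\<^esub>" and d = "\<one>\<^bsub>G\<^esub>"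
      and x = "\<one>\<^bsub>L\<^esub>" and y = "\<one>\<^bsub>L\<^esub>" and z = x and w = y]
    cocycle_pair[where a = g and b = "\<one>\<^bsub>G\<^esub>" and c = h and d = "\<one>\<^bsub>G\<^esub>"
      and x = "\<one>\<^bsub>L\<^esub>" and y = "\<rho> h x" and z = "\<one>\<^bsub>L\<^esub>" and w = y]
    cocycle_pair[where a = g and b = "\<one>\<^bsub>G\<^esub>" and c = "\<one>\<^bsub>G\<^esub>" and d = h
      and x = "\<one>\<^bsub>L\<^esub>" and y = "\<rho> h x" and z = "\<rho> h y" and w = "\<one>\<^bsub>L\<^esub>"]
    cocycle_pair[where a = "\<one>\<^bsub>G\<^esub>" and b = g and c = h and d = "\<one>\<^bsub>G\<^esub>"
      and x = "\<rho> (g \<otimes>\<^bsub>G\<^esub> h) x" and y = "\<one>\<^bsub>L\<^esub>" and z = "\<one>\<^bsub>L\<^esub>" and w = y]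
    cocycle_pair[where a = "\<one>\<^bsub>G\<^esub>" and b = g and c = "\<one>\<^bsub>G\<^esub>" and d = h
      and x = "\<rho> (g \<otimes>\<^bsub>G\<^esub> h) x" and y = "\<one>\<^bsub>L\<^esub>" and z = "\<rho> h y" and w = "\<one>\<^bsub>L\<^esub>"]
    cocycle_pair[where a = "\<one>\<^bsub>G\<^esub>" and b = "\<one>\<^bsub>G\<^esub>" and c = g and d = h
      and x = "\<rho> (g \<otimes>\<^bsub>G\<^esub> h) x" and y = "\<rho> (g \<otimes>\<^bsub>G\<^esub> h) y" and z = "\<one>\<^bsub>L\<^esub>" and w = "\<one>\<^bsub>L\<^esub>"]
    by (simp add: shuffle_def z_def action_mult)
  from this[of x y] this[of y x] show ?thesis
    by (simp add: L.m_comm[of y x])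
qed

end

end

section \<open>Lifting a trilinear form to the semi-direct product\<close>

context semidirect
begin

text \<open>An entry from \<open>N\<close> behind the first \<open>n - p\<close> ones lies in the
  coset of the unit. It may therefore be replaced by the unit, and normalized cochains vanish
  there.\<close>

lemma lhs_filtration_kernel_entry:
  assumes f: "f \<in> lhs_filtration \<Gamma> N p n" and n: "int (length (as @ a # bs)) = n"
    and p: "n - p \<le> int (length as)"
    and carr: "set as \<subseteq> carrier \<Gamma>" "a \<in> N" "set bs \<subseteq> carrier \<Gamma>"
  shows "f (as @ a # bs) = 0"
proof (cases "n < p")
  case True
  then show ?thesis using f by (simp add: lhs_filtration_def)
next
  case False
  obtain x where "a = (x, \<one>\<^bsub>G\<^esub>)" "x \<in> carrier L"
    using carr(2) by (auto simp: semidirect_kernel_def)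
  then have a: "a \<in> carrier \<Gamma>" "a <#\<^bsub>\<Gamma>\<^esub> N = \<one>\<^bsub>\<Gamma>\<^esub> <#\<^bsub>\<Gamma>\<^esub> N"
    by (simp_all add: coset_kernel)
  let ?k = "nat (n - p)"
  have k: "?k \<le> length as" using p by simp
  have "f (as @ a # bs) = f (as @ \<one>\<^bsub>\<Gamma>\<^esub> # bs)"
  proof -
    have "list_all2 (\<lambda>x y. x <#\<^bsub>\<Gamma>\<^esub> N = y <#\<^bsub>\<Gamma>\<^esub> N)
        (drop ?k (as @ a # bs)) (drop ?k (as @ \<one>\<^bsub>\<Gamma>\<^esub> # bs))"
      using k a(2) by (simp add: list_all2_append list_all2_refl del: one_semidirect)
    moreover have "take ?k (as @ a # bs) = take ?k (as @ \<one>\<^bsub>\<Gamma>\<^esub> # bs)"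
      using k by simp
    ultimately show ?thesis
      using f False n a(1) carr(1,3) unfolding lhs_filtration_def by auto
  qed
  also have "\<dots> = 0"
    using f False by (intro cochain_eq_0_one[of f \<Gamma> n]) (simp_all add: lhs_filtration_def)
  finally show ?thesis .
qed

text \<open>The inverse makes this a right action. Acting on an entry of a tuple by the product of
  all group components from its own one to the right end moves all entries into common
  coordinates.\<close>

definition right_action :: "'l \<Rightarrow> 'g \<Rightarrow> 'l" (infixl "\<triangleleft>" 75) where
  "x \<triangleleft> g = \<rho> (inv\<^bsub>G\<^esub> g) x"

lemma right_action_closed [simp]:
  "\<lbrakk>x \<in> carrier L; g \<in> carrier G\<rbrakk> \<Longrightarrow> x \<triangleleft> g \<in> carrier L"
  by (simp add: right_action_def)

lemma right_action_zero [simp]: "g \<in> carrier G \<Longrightarrow> \<one>\<^bsub>L\<^esub> \<triangleleft> g = \<one>\<^bsub>L\<^esub>"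
  by (simp add: right_action_def)

lemma right_action_one [simp]: "x \<in> carrier L \<Longrightarrow> x \<triangleleft> \<one>\<^bsub>G\<^esub> = x"
  by (simp add: right_action_def)

lemma right_action_add [simp]:
  "\<lbrakk>x \<in> carrier L; y \<in> carrier L; g \<in> carrier G\<rbrakk> \<Longrightarrow> (x \<otimes>\<^bsub>L\<^esub> y) \<triangleleft> g = x \<triangleleft> g \<otimes>\<^bsub>L\<^esub> y \<triangleleft> g"
  by (simp add: right_action_def)

text \<open>This rule handles the multiplication of neighbouring entries in these coordinates; the
  next one handles the change of reference point when the last entry is dropped.\<close>

lemma right_action_action [simp]:
  "\<lbrakk>x \<in> carrier L; g \<in> carrier G; h \<in> carrier G\<rbrakk> \<Longrightarrow> \<rho> g x \<triangleleft> (g \<otimes>\<^bsub>G\<^esub> h) = x \<triangleleft> h"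
  by (simp add: right_action_def G.inv_mult_group G.m_assoc flip: action_mult)

lemma action_right_action [simp]:
  "\<lbrakk>x \<in> carrier L; g \<in> carrier G; h \<in> carrier G\<rbrakk> \<Longrightarrow> \<rho> h (x \<triangleleft> (g \<otimes>\<^bsub>G\<^esub> h)) = x \<triangleleft> g"
  by (simp add: right_action_def G.inv_mult_group flip: action_mult G.m_assoc)

end


text \<open>The two laws for \<open>q g\<close> say that, as a bar 2-cochain on \<open>L\<close>, it
  has coboundary \<beta> minus the pullback of \<beta> along \<open>\<rho> g\<close>. This is also
  the coboundary of \<open>shuffle u g\<close> for every \<open>u\<close> that restricts to
  \<beta>.\<close>

locale quadratic_defect = semidirect L G \<rho>
  for L :: "'l monoid" and G :: "'g monoid" and \<rho> +
  fixes \<beta> :: "'l \<Rightarrow> 'l \<Rightarrow> 'l \<Rightarrow> int" and q :: "'g \<Rightarrow> 'l \<Rightarrow> 'l \<Rightarrow> int"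
  assumes \<beta>_add_1: "\<lbrakk>x \<in> carrier L; x' \<in> carrier L; y \<in> carrier L; z \<in> carrier L\<rbrakk> \<Longrightarrow>
      \<beta> (x \<otimes>\<^bsub>L\<^esub> x') y z = \<beta> x y z + \<beta> x' y z"
    and \<beta>_add_2: "\<lbrakk>x \<in> carrier L; y \<in> carrier L; y' \<in> carrier L; z \<in> carrier L\<rbrakk> \<Longrightarrow>
      \<beta> x (y \<otimes>\<^bsub>L\<^esub> y') z = \<beta> x y z + \<beta> x y' z"
    and \<beta>_add_3: "\<lbrakk>x \<in> carrier L; y \<in> carrier L; z \<in> carrier L; z' \<in> carrier L\<rbrakk> \<Longrightarrow>
      \<beta> x y (z \<otimes>\<^bsub>L\<^esub> z') = \<beta> x y z + \<beta> x y z'"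
    and q_one: "\<lbrakk>x \<in> carrier L; y \<in> carrier L\<rbrakk> \<Longrightarrow> q \<one>\<^bsub>G\<^esub> x y = 0"
    and q_add_1: "\<lbrakk>g \<in> carrier G; x \<in> carrier L; x' \<in> carrier L; y \<in> carrier L\<rbrakk> \<Longrightarrow>
      q g (x \<otimes>\<^bsub>L\<^esub> x') y = q g x y + q g x' y + (\<beta> (\<rho> g x) (\<rho> g x') (\<rho> g y) - \<beta> x x' y)"
    and q_add_2: "\<lbrakk>g \<in> carrier G; x \<in> carrier L; y \<in> carrier L; y' \<in> carrier L\<rbrakk> \<Longrightarrow>
      q g x (y \<otimes>\<^bsub>L\<^esub> y') = q g x y + q g x y'"
begin

lemma \<beta>_zero [simp]:
  assumes "x \<in> carrier L" "y \<in> carrier L"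
  shows "\<beta> \<one>\<^bsub>L\<^esub> x y = 0" "\<beta> x \<one>\<^bsub>L\<^esub> y = 0" "\<beta> x y \<one>\<^bsub>L\<^esub> = 0"
  using \<beta>_add_1[of "\<one>\<^bsub>L\<^esub>" "\<one>\<^bsub>L\<^esub>" x y] \<beta>_add_2[of x "\<one>\<^bsub>L\<^esub>" "\<one>\<^bsub>L\<^esub>" y]
    \<beta>_add_3[of x y "\<one>\<^bsub>L\<^esub>" "\<one>\<^bsub>L\<^esub>"] assms by simp_all

lemma q_zero [simp]:
  assumes "g \<in> carrier G" "x \<in> carrier L"
  shows "q g \<one>\<^bsub>L\<^esub> x = 0" "q g x \<one>\<^bsub>L\<^esub> = 0"
  using q_add_1[of g "\<one>\<^bsub>L\<^esub>" "\<one>\<^bsub>L\<^esub>" x] q_add_2[of g x "\<one>\<^bsub>L\<^esub>" "\<one>\<^bsub>L\<^esub>"] assms by simp_all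

text \<open>
  The first summand is the cup product of three copies of the crossed homomorphism
  \<open>(x, g) \<mapsto> x \<triangleleft> g\<close>, contracted with \<open>\<beta>\<close>; its coboundary is the defect of invariance of \<open>\<beta>\<close>.
  The second summand cancels that defect and pushes the coboundary from \<open>F\<^sup>1\<close> into \<open>F\<^sup>2\<close>.
\<close>

definition lift_triple :: "'l \<times> 'g \<Rightarrow> 'l \<times> 'g \<Rightarrow> 'l \<times> 'g \<Rightarrow> int" where
  "lift_triple = (\<lambda>(x, g) (y, h) (z, k).
     \<beta> (x \<triangleleft> (g \<otimes>\<^bsub>G\<^esub> (h \<otimes>\<^bsub>G\<^esub> k))) (y \<triangleleft> (h \<otimes>\<^bsub>G\<^esub> k)) (z \<triangleleft> k)
     + q k (x \<triangleleft> (g \<otimes>\<^bsub>G\<^esub> (h \<otimes>\<^bsub>G\<^esub> k))) (y \<triangleleft> (h \<otimes>\<^bsub>G\<^esub> k)))"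

definition lift :: "('l \<times> 'g) list \<Rightarrow> int" where
  "lift xs = (case xs of [a, b, c] \<Rightarrow> if set xs \<subseteq> carrier \<Gamma> then lift_triple a b c else 0 | _ \<Rightarrow> 0)"

lemma lift_3:
  "\<lbrakk>a \<in> carrier \<Gamma>; b \<in> carrier \<Gamma>; c \<in> carrier \<Gamma>\<rbrakk> \<Longrightarrow> lift [a, b, c] = lift_triple a b c"
  by (simp add: lift_def)

lemma lift_triple_one:
  assumes "a \<in> carrier \<Gamma>" "b \<in> carrier \<Gamma>" "c \<in> carrier \<Gamma>" "a = \<one>\<^bsub>\<Gamma>\<^esub> \<or> b = \<one>\<^bsub>\<Gamma>\<^esub> \<or> c = \<one>\<^bsub>\<Gamma>\<^esub>"
  shows "lift_triple a b c = 0"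
  using assms by (cases a; cases b; cases c) (auto simp: lift_triple_def q_one)

lemma lift_cochain: "lift \<in> cochains \<Gamma> 3"
proof -
  have "int (length xs) = 3 \<and> set xs \<subseteq> carrier \<Gamma> \<and> \<one>\<^bsub>\<Gamma>\<^esub> \<notin> set xs" if "lift xs \<noteq> 0" for xs
    using that lift_triple_one by (auto simp: lift_def split: list.splits if_splits)
  then show ?thesis by (simp add: cochains_def)
qed

text \<open>The failure of \<open>q\<close> to be a crossed homomorphism on \<open>G\<close>. The
  polarizations of the three summands cancel, so it is bilinear in \<open>x\<close> and
  \<open>y\<close>.\<close>

definition defect :: "'g \<Rightarrow> 'g \<Rightarrow> 'l \<Rightarrow> 'l \<Rightarrow> int" where
  "defect g h x y = q h x y + q g (\<rho> h x) (\<rho> h y) - q (g \<otimes>\<^bsub>G\<^esub> h) x y"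

text \<open>In coordinates at the right end, trilinearity cancels all \<beta>-terms up to the change
  of reference point by \<open>l\<close> in the face that drops the last entry. What is left of
  \<beta> is the polarization of \<open>q l\<close>, and it cancels against the
  \<open>q\<close>-terms except for the defect.\<close>

lemma coboundary_lift:
  assumes "x \<in> carrier L" "y \<in> carrier L" "z \<in> carrier L" "w \<in> carrier L"
    and "g \<in> carrier G" "h \<in> carrier G" "k \<in> carrier G" "l \<in> carrier G"
  shows "coboundary \<Gamma> lift [(x, g), (y, h), (z, k), (w, l)]
    = defect k l (x \<triangleleft> (g \<otimes>\<^bsub>G\<^esub> (h \<otimes>\<^bsub>G\<^esub> (k \<otimes>\<^bsub>G\<^esub> l)))) (y \<triangleleft> (h \<otimes>\<^bsub>G\<^esub> (k \<otimes>\<^bsub>G\<^esub> l)))"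
proof -
  define Y1 Y2 Y3 Y4 where "Y1 = x \<triangleleft> (g \<otimes>\<^bsub>G\<^esub> (h \<otimes>\<^bsub>G\<^esub> (k \<otimes>\<^bsub>G\<^esub> l)))"
    and "Y2 = y \<triangleleft> (h \<otimes>\<^bsub>G\<^esub> (k \<otimes>\<^bsub>G\<^esub> l))" and "Y3 = z \<triangleleft> (k \<otimes>\<^bsub>G\<^esub> l)" and "Y4 = w \<triangleleft> l"
  note Y = this
  have [simp]: "Y1 \<in> carrier L" "Y2 \<in> carrier L" "Y3 \<in> carrier L" "Y4 \<in> carrier L"
    using assms by (simp_all add: Y)
  have low: "x \<triangleleft> (g \<otimes>\<^bsub>G\<^esub> (h \<otimes>\<^bsub>G\<^esub> k)) = \<rho> l Y1" "y \<triangleleft> (h \<otimes>\<^bsub>G\<^esub> k) = \<rho> l Y2" "z \<triangleleft> k = \<rho> l Y3"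
    using assms by (simp_all add: Y flip: G.m_assoc)
  show ?thesis
    using assms
    by (simp add: coboundary_4 lift_3 lift_triple_def G.m_assoc low Y[symmetric]
        \<beta>_add_1 \<beta>_add_2 \<beta>_add_3 q_add_1 q_add_2 defect_def)
qed

text \<open>In \<open>coboundary_lift\<close> the last two entries occur only through their group
  components, that is, through their cosets modulo \<open>N\<close>.\<close>

lemma coboundary_lift_filtration: "coboundary \<Gamma> lift \<in> lhs_filtration \<Gamma> N 2 4"
proof -
  have len: "length xs = 4" if "coboundary \<Gamma> lift xs \<noteq> 0" for xs
    using coboundary_eq_0_length[OF lift_cochain, of xs] that by force
  have "set xs \<subseteq> carrier \<Gamma> \<and> \<one>\<^bsub>\<Gamma>\<^esub> \<notin> set xs" if nz: "coboundary \<Gamma> lift xs \<noteq> 0" for xs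
  proof -
    obtain x g y h z k w l where xs: "xs = [(x, g), (y, h), (z, k), (w, l)]"
      using len[OF nz] by (auto simp: length_Suc_conv eval_nat_numeral)
    have carr: "set xs \<subseteq> carrier \<Gamma>"
      using nz by (auto simp: coboundary_def split: if_splits)
    then show ?thesis
      using nz unfolding xs by (auto simp: coboundary_lift defect_def q_one)
  qed
  moreover have "coboundary \<Gamma> lift xs = coboundary \<Gamma> lift ys"
    if xs: "int (length xs) = 4" and ys: "int (length ys) = 4"
      and carr: "set xs \<subseteq> carrier \<Gamma>" "set ys \<subseteq> carrier \<Gamma>"
      and eq: "take (nat (4 - 2)) xs = take (nat (4 - 2)) ys"
      and cosets: "list_all2 (\<lambda>x y. x <#\<^bsub>\<Gamma>\<^esub> N = y <#\<^bsub>\<Gamma>\<^esub> N)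
        (drop (nat (4 - 2)) xs) (drop (nat (4 - 2)) ys)" for xs ys
  proof -
    obtain x g y h z k w l where xs': "xs = [(x, g), (y, h), (z, k), (w, l)]"
      using xs by (auto simp: length_Suc_conv eval_nat_numeral)
    obtain x' g' y' h' z' k' w' l' where ys': "ys = [(x', g'), (y', h'), (z', k'), (w', l')]"
      using ys by (auto simp: length_Suc_conv eval_nat_numeral)
    show ?thesis
      using carr eq cosets unfolding xs' ys' by (simp add: coboundary_lift coset_kernel_eq_iff)
  qed
  ultimately show ?thesis
    using len by (simp add: lhs_filtration_def cochains_def)
qed

lemma lift_mem_lhs_Z: "lift \<in> lhs_Z \<Gamma> N 2 0 3"
proof -
  have "lift \<in> lhs_filtration \<Gamma> N 0 3"
    using lift_cochain by (simp add: lhs_filtration_def) (intro allI impI, elim conjE, simp)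
  then show ?thesis
    using coboundary_lift_filtration by (simp add: lhs_Z_def)
qed

end

section \<open>The obstruction to the vanishing of the second differential\<close>

context quadratic_defect
begin

theorem norm_of_defect_if_trivial:
  fixes m :: nat
  assumes trivial: "lhs_differential_trivial \<Gamma> N 2"
    and t: "t \<in> carrier G" "t [^]\<^bsub>G\<^esub> m = \<one>\<^bsub>G\<^esub>"
  obtains \<omega> where "biadditive L \<omega>"
    and "\<And>x y. \<lbrakk>x \<in> carrier L; y \<in> carrier L\<rbrakk> \<Longrightarrow>
      (\<Sum>i<m. q t (\<rho> (t [^]\<^bsub>G\<^esub> i) x) (\<rho> (t [^]\<^bsub>G\<^esub> i) y)
        - q t (\<rho> (t [^]\<^bsub>G\<^esub> i) y) (\<rho> (t [^]\<^bsub>G\<^esub> i) x)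
        + \<omega> (\<rho> (t [^]\<^bsub>G\<^esub> i) x) (\<rho> (t [^]\<^bsub>G\<^esub> i) y)) = 0"
proof -
  have "coboundary \<Gamma> lift \<in> lhs_B \<Gamma> N 2 2 2"
    using coboundary_mem_lhs_B[OF trivial lift_mem_lhs_Z] by simp
  \<comment> \<open>At r = p = q = 2 the group \<open>lhs_B\<close> is Z_1^{3,1} plus the
    coboundaries of Z_1^{1,2}; this gives F^3 in degree 4 for \<open>c\<close> and F^1 in degree 3
    for \<open>h\<close>.\<close>
  then obtain c h where c: "c \<in> lhs_filtration \<Gamma> N 3 4" and h: "h \<in> lhs_filtration \<Gamma> N 1 3"
    and eq: "coboundary \<Gamma> lift = (\<lambda>xs. c xs + coboundary \<Gamma> h xs)"
    by (auto simp: lhs_B_def lhs_Z_def set_mult_def cochain_group_def)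
  define u where "u a b c = lift [a, b, c] - h [a, b, c]" for a b c
  have "u b c d - u (a \<otimes>\<^bsub>\<Gamma>\<^esub> b) c d + u a (b \<otimes>\<^bsub>\<Gamma>\<^esub> c) d - u a b (c \<otimes>\<^bsub>\<Gamma>\<^esub> d) + u a b c = 0"
    if carr: "a \<in> carrier \<Gamma>" "b \<in> carrier \<Gamma>" "c \<in> carrier \<Gamma>" "d \<in> carrier \<Gamma>"
      and N: "b \<in> N \<or> c \<in> N \<or> d \<in> N" for a b c d
  proof -
    have "c' [a, b, c, d] = 0" if c': "c' \<in> lhs_filtration \<Gamma> N 3 4" for c'
      using N lhs_filtration_kernel_entry[OF c', of "[a]" b "[c, d]"]
        lhs_filtration_kernel_entry[OF c', of "[a, b]" c "[d]"]
        lhs_filtration_kernel_entry[OF c', of "[a, b, c]" d "[]"] carr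
      by auto
    then have "coboundary \<Gamma> lift [a, b, c, d] = coboundary \<Gamma> h [a, b, c, d]"
      using c by (simp add: eq)
    then show ?thesis
      using carr by (simp add: coboundary_4 u_def)
  qed
  note cocycle = this
  \<comment> \<open>Subtracting \<open>h\<close> does not change the restriction to
    \<open>L\<close>: a 3-cochain in F^1 vanishes as soon as its last entry is in
    \<open>N\<close>.\<close>
  have u_kernel: "u (x, \<one>\<^bsub>G\<^esub>) (y, \<one>\<^bsub>G\<^esub>) (z, \<one>\<^bsub>G\<^esub>) = \<beta> x y z"
    if "x \<in> carrier L" "y \<in> carrier L" "z \<in> carrier L" for x y z
    using lhs_filtration_kernel_entry[OF h, of "[(x, \<one>\<^bsub>G\<^esub>), (y, \<one>\<^bsub>G\<^esub>)]" "(z, \<one>\<^bsub>G\<^esub>)" "[]"] that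
    by (simp add: u_def lift_3 lift_triple_def q_one semidirect_kernel_def)
  have u_one: "u a b c = 0"
    if "\<one>\<^bsub>\<Gamma>\<^esub> \<in> {a, b, c}" for a b c
  proof -
    have "h \<in> cochains \<Gamma> 3" using h by (simp add: lhs_filtration_def)
    then show ?thesis
      using that by (simp add: u_def cochain_eq_0_one[OF lift_cochain] cochain_eq_0_one[of h \<Gamma> 3] del: one_semidirect)
  qed
  define W where "W g x y = shuffle u g x y - shuffle u g y x" for g x y
  have W_mult: "W (g \<otimes>\<^bsub>G\<^esub> k) x y = W g (\<rho> k x) (\<rho> k y) + W k x y"
    if "g \<in> carrier G" "k \<in> carrier G" "x \<in> carrier L" "y \<in> carrier L" for g k x y
    using alternating_shuffle_mult[OF cocycle that] by (simp add: W_def)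
  have W_power: "W (t [^]\<^bsub>G\<^esub> n) x y
      = (\<Sum>i<n. W t (\<rho> (t [^]\<^bsub>G\<^esub> i) x) (\<rho> (t [^]\<^bsub>G\<^esub> i) y))"
    if "x \<in> carrier L" "y \<in> carrier L" for n :: nat and x y
  proof (induction n)
    case 0
    then show ?case using that by (simp add: W_def shuffle_def u_one)
  next
    case (Suc n)
    \<comment> \<open>Splitting off \<open>t\<close> on the left makes the new summand
      \<open>W t\<close> at the images under the \<open>n\<close>-th power, as the sum
      requires.\<close>
    have "W (t [^]\<^bsub>G\<^esub> Suc n) x y = W (t \<otimes>\<^bsub>G\<^esub> t [^]\<^bsub>G\<^esub> n) x y"
      using t(1) by (simp only: G.nat_pow_Suc2)
    then show ?case
      using Suc that t(1) by (simp add: W_mult)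
  qed
  \<comment> \<open>\<open>shuffle u t\<close> and \<open>q t\<close> have the same coboundary on
    \<open>L\<close>, so their difference is a 2-cocycle, and its alternation is biadditive.\<close>
  define \<omega> where "\<omega> x y = (shuffle u t x y - q t x y) - (shuffle u t y x - q t y x)" for x y
  have "biadditive L \<omega>"
    unfolding \<omega>_def
  proof (rule biadditive_alternation_2_cocycle[OF L.comm_group_axioms])
    fix x y z assume xyz: "x \<in> carrier L" "y \<in> carrier L" "z \<in> carrier L"
    show "shuffle u t y z - q t y z - (shuffle u t (x \<otimes>\<^bsub>L\<^esub> y) z - q t (x \<otimes>\<^bsub>L\<^esub> y) z)
      + (shuffle u t x (y \<otimes>\<^bsub>L\<^esub> z) - q t x (y \<otimes>\<^bsub>L\<^esub> z)) - (shuffle u t x y - q t x y) = 0"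
      using shuffle_homotopy[OF cocycle t(1) xyz] xyz t(1)
      by (simp add: u_kernel q_add_1 q_add_2)
  qed
  moreover have "(\<Sum>i<m. q t (\<rho> (t [^]\<^bsub>G\<^esub> i) x) (\<rho> (t [^]\<^bsub>G\<^esub> i) y)
        - q t (\<rho> (t [^]\<^bsub>G\<^esub> i) y) (\<rho> (t [^]\<^bsub>G\<^esub> i) x)
        + \<omega> (\<rho> (t [^]\<^bsub>G\<^esub> i) x) (\<rho> (t [^]\<^bsub>G\<^esub> i) y)) = 0"
    if xy: "x \<in> carrier L" "y \<in> carrier L" for x y
  proof -
    have "W \<one>\<^bsub>G\<^esub> x y = 0"
      using W_power[OF xy, of 0] by simp
    then have "(\<Sum>i<m. W t (\<rho> (t [^]\<^bsub>G\<^esub> i) x) (\<rho> (t [^]\<^bsub>G\<^esub> i) y)) = 0"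
      using W_power[OF xy, of m] t(2) by simp
    then show ?thesis
      by (simp add: W_def \<omega>_def algebra_simps)
  qed
  ultimately show thesis by (rule that)
qed

end

context semidirect
begin

text \<open>It suffices to give \<open>q\<close> for the generator. Write each \<open>g\<close> as a
  power of \<open>t\<close> and sum \<open>q\<close> along the smaller powers; the polarizations
  telescope from \<beta> to its pullback along \<open>\<rho> g\<close>. The result need not be a
  crossed homomorphism, since exponents add only modulo the order.\<close>

theorem norm_of_defect_if_trivial_cyclic:
  fixes \<beta> :: "'l \<Rightarrow> 'l \<Rightarrow> 'l \<Rightarrow> int" and q :: "'l \<Rightarrow> 'l \<Rightarrow> int" and m :: nat
  assumes trivial: "lhs_differential_trivial \<Gamma> N 2"
    and G: "finite (carrier G)" "carrier G = generate G {t}"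
    and t: "t \<in> carrier G" "t \<noteq> \<one>\<^bsub>G\<^esub>" "t [^]\<^bsub>G\<^esub> m = \<one>\<^bsub>G\<^esub>"
    and \<beta>: "\<And>x x' y z. \<lbrakk>x \<in> carrier L; x' \<in> carrier L; y \<in> carrier L; z \<in> carrier L\<rbrakk> \<Longrightarrow>
        \<beta> (x \<otimes>\<^bsub>L\<^esub> x') y z = \<beta> x y z + \<beta> x' y z"
      "\<And>x y y' z. \<lbrakk>x \<in> carrier L; y \<in> carrier L; y' \<in> carrier L; z \<in> carrier L\<rbrakk> \<Longrightarrow>
        \<beta> x (y \<otimes>\<^bsub>L\<^esub> y') z = \<beta> x y z + \<beta> x y' z"
      "\<And>x y z z'. \<lbrakk>x \<in> carrier L; y \<in> carrier L; z \<in> carrier L; z' \<in> carrier L\<rbrakk> \<Longrightarrow>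
        \<beta> x y (z \<otimes>\<^bsub>L\<^esub> z') = \<beta> x y z + \<beta> x y z'"
    and q_add_1: "\<And>x x' y. \<lbrakk>x \<in> carrier L; x' \<in> carrier L; y \<in> carrier L\<rbrakk> \<Longrightarrow>
      q (x \<otimes>\<^bsub>L\<^esub> x') y = q x y + q x' y + (\<beta> (\<rho> t x) (\<rho> t x') (\<rho> t y) - \<beta> x x' y)"
    and q_add_2: "\<And>x y y'. \<lbrakk>x \<in> carrier L; y \<in> carrier L; y' \<in> carrier L\<rbrakk> \<Longrightarrow>
      q x (y \<otimes>\<^bsub>L\<^esub> y') = q x y + q x y'"
  obtains \<omega> where "biadditive L \<omega>"
    and "\<And>x y. \<lbrakk>x \<in> carrier L; y \<in> carrier L\<rbrakk> \<Longrightarrow>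
      (\<Sum>i<m. q (\<rho> (t [^]\<^bsub>G\<^esub> i) x) (\<rho> (t [^]\<^bsub>G\<^esub> i) y)
        - q (\<rho> (t [^]\<^bsub>G\<^esub> i) y) (\<rho> (t [^]\<^bsub>G\<^esub> i) x)
        + \<omega> (\<rho> (t [^]\<^bsub>G\<^esub> i) x) (\<rho> (t [^]\<^bsub>G\<^esub> i) y)) = 0"
proof -
  \<comment> \<open>The least exponent is 0 for the unit and 1 for \<open>t\<close>, so that
    \<open>Q\<close> vanishes at the unit and equals \<open>q\<close> at \<open>t\<close>.\<close>
  define k where "k g = (LEAST k. t [^]\<^bsub>G\<^esub> (k :: nat) = g)" for g
  have k: "t [^]\<^bsub>G\<^esub> k g = g" if "g \<in> carrier G" for g
  proof -
    have "\<exists>k :: nat. t [^]\<^bsub>G\<^esub> k = g"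
      using that G G.generate_pow_on_finite_carrier[OF G(1) t(1)] by auto
    then show ?thesis
      unfolding k_def by (rule LeastI_ex)
  qed
  have k_one: "k \<one>\<^bsub>G\<^esub> = 0"
    unfolding k_def by (rule Least_eq_0) simp
  have k_t: "k t = 1"
    unfolding k_def
  proof (rule Least_equality)
    fix n :: nat assume "t [^]\<^bsub>G\<^esub> n = t"
    then show "1 \<le> n" using t(2) by (cases n) auto
  qed (use t(1) in simp)
  define Q where "Q g x y = (\<Sum>i<k g. q (\<rho> (t [^]\<^bsub>G\<^esub> i) x) (\<rho> (t [^]\<^bsub>G\<^esub> i) y))" for g x y
  interpret quadratic_defect L G \<rho> \<beta> Q
  proof
    fix x y assume "x \<in> carrier L" "y \<in> carrier L"
    then show "Q \<one>\<^bsub>G\<^esub> x y = 0" by (simp add: Q_def k_one)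
  next
    fix g x x' y
    assume g: "g \<in> carrier G" and x: "x \<in> carrier L" "x' \<in> carrier L" "y \<in> carrier L"
    let ?B = "\<lambda>i. \<beta> (\<rho> (t [^]\<^bsub>G\<^esub> i) x) (\<rho> (t [^]\<^bsub>G\<^esub> i) x') (\<rho> (t [^]\<^bsub>G\<^esub> i) y)"
    have B: "?B (Suc i) = \<beta> (\<rho> t (\<rho> (t [^]\<^bsub>G\<^esub> i) x)) (\<rho> t (\<rho> (t [^]\<^bsub>G\<^esub> i) x')) (\<rho> t (\<rho> (t [^]\<^bsub>G\<^esub> i) y))"
      for i :: nat
      using t(1) x by (simp only: G.nat_pow_Suc2) (simp add: action_mult)
    have "Q g (x \<otimes>\<^bsub>L\<^esub> x') y = Q g x y + Q g x' y + (\<Sum>i<k g. ?B (Suc i) - ?B i)"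
      using t(1) x unfolding Q_def B by (simp add: q_add_1 sum.distrib sum_subtractf)
    also have "\<dots> = Q g x y + Q g x' y + (\<beta> (\<rho> g x) (\<rho> g x') (\<rho> g y) - \<beta> x x' y)"
      using sum_lessThan_telescope[of ?B "k g"] k[OF g] x by simp
    finally show "Q g (x \<otimes>\<^bsub>L\<^esub> x') y
      = Q g x y + Q g x' y + (\<beta> (\<rho> g x) (\<rho> g x') (\<rho> g y) - \<beta> x x' y)" .
  next
    fix g x y y'
    assume "g \<in> carrier G" "x \<in> carrier L" "y \<in> carrier L" "y' \<in> carrier L"
    then show "Q g x (y \<otimes>\<^bsub>L\<^esub> y') = Q g x y + Q g x y'"
      using t(1) by (simp add: Q_def q_add_2 sum.distrib)
  qed (fact \<beta>)+
  have Q_t: "Q t x y = q x y" if "x \<in> carrier L" "y \<in> carrier L" for x y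
    using that by (simp add: Q_def k_t)
  show thesis
  proof (rule norm_of_defect_if_trivial[OF trivial t(1) t(3)])
    fix \<omega> assume "biadditive L \<omega>"
      and "\<And>x y. \<lbrakk>x \<in> carrier L; y \<in> carrier L\<rbrakk> \<Longrightarrow>
        (\<Sum>i<m. Q t (\<rho> (t [^]\<^bsub>G\<^esub> i) x) (\<rho> (t [^]\<^bsub>G\<^esub> i) y)
          - Q t (\<rho> (t [^]\<^bsub>G\<^esub> i) y) (\<rho> (t [^]\<^bsub>G\<^esub> i) x)
          + \<omega> (\<rho> (t [^]\<^bsub>G\<^esub> i) x) (\<rho> (t [^]\<^bsub>G\<^esub> i) y)) = 0"
    then show thesis
      using t(1) by (intro that[of \<omega>]) (simp_all add: Q_t)
  qed
qed

end

section \<open>The matrix of order four\<close>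

definition vec6 :: "int \<Rightarrow> int \<Rightarrow> int \<Rightarrow> int \<Rightarrow> int \<Rightarrow> int \<Rightarrow> int vec" where
  "vec6 a b c d e f = vec 6 ((!) [a, b, c, d, e, f])"

lemma vec6_carrier [simp]: "vec6 a b c d e f \<in> carrier_vec 6"
  by (simp add: vec6_def)

lemma vec6_index [simp]:
  "vec6 a b c d e f $ 0 = a" "vec6 a b c d e f $ Suc 0 = b" "vec6 a b c d e f $ 2 = c"
  "vec6 a b c d e f $ 3 = d" "vec6 a b c d e f $ 4 = e" "vec6 a b c d e f $ 5 = f"
  by (simp_all add: vec6_def)

lemma eq_vec_6I:
  fixes v w :: "'a vec"
  assumes "v \<in> carrier_vec 6" "w \<in> carrier_vec 6"
    and "v $ 0 = w $ 0" "v $ 1 = w $ 1" "v $ 2 = w $ 2" "v $ 3 = w $ 3" "v $ 4 = w $ 4" "v $ 5 = w $ 5"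
  shows "v = w"
proof (rule eq_vecI)
  fix i assume "i < dim_vec w"
  then have "i \<in> {0, 1, 2, 3, 4, 5}" using assms(2) by auto
  then show "v $ i = w $ i" using assms by auto
qed (use assms in simp)

lemma the_matrix_mult_closed [simp]: "the_matrix *\<^sub>v v \<in> carrier_vec 6"
  by (rule carrier_vecI) (simp add: the_matrix_def mat_of_rows_list_def)

lemma the_matrix_mult_index [simp]:
  assumes "v \<in> carrier_vec 6"
  shows "(the_matrix *\<^sub>v v) $ 0 = v $ Suc 0" "(the_matrix *\<^sub>v v) $ Suc 0 = v $ 2 - v $ 0"
    "(the_matrix *\<^sub>v v) $ 2 = v $ 2" "(the_matrix *\<^sub>v v) $ 3 = v $ 3"
    "(the_matrix *\<^sub>v v) $ 4 = v $ 5 - v $ 3" "(the_matrix *\<^sub>v v) $ 5 = - v $ 4"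
proof -
  have set6: "{0..<6} = {0, 1, 2, 3, 4, 5 :: nat}" by auto
  show "(the_matrix *\<^sub>v v) $ 0 = v $ Suc 0" "(the_matrix *\<^sub>v v) $ Suc 0 = v $ 2 - v $ 0"
    "(the_matrix *\<^sub>v v) $ 2 = v $ 2" "(the_matrix *\<^sub>v v) $ 3 = v $ 3"
    "(the_matrix *\<^sub>v v) $ 4 = v $ 5 - v $ 3" "(the_matrix *\<^sub>v v) $ 5 = - v $ 4"
    using assms by (simp_all add: the_matrix_def mat_of_rows_list_def scalar_prod_def set6)
qed

lemma the_matrix_mult_vec6:
  "the_matrix *\<^sub>v vec6 a b c d e f = vec6 b (c - a) c d (f - d) (- e)"
  by (rule eq_vec_6I) simp_all

lemma additive_smult_vec:
  fixes \<phi> :: "int vec \<Rightarrow> int"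
  assumes add: "\<And>x y. \<lbrakk>x \<in> carrier_vec n; y \<in> carrier_vec n\<rbrakk> \<Longrightarrow> \<phi> (x + y) = \<phi> x + \<phi> y"
    and v: "v \<in> carrier_vec n"
  shows "\<phi> (k \<cdot>\<^sub>v v) = k * \<phi> v"
proof (induction k rule: int_induct[where k = 0])
  case base
  have "(0 :: int) \<cdot>\<^sub>v v = 0\<^sub>v n" using v by auto
  moreover have "\<phi> (0\<^sub>v n) = 0" using add[of "0\<^sub>v n" "0\<^sub>v n"] by simp
  ultimately show ?case by simp
next
  case (step1 i)
  have "(i + 1) \<cdot>\<^sub>v v = i \<cdot>\<^sub>v v + v" using v by (simp add: add_smult_distrib_vec)
  then show ?case using step1 add[of "i \<cdot>\<^sub>v v" v] v by (simp add: algebra_simps)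
next
  case (step2 i)
  have "i \<cdot>\<^sub>v v = (i - 1) \<cdot>\<^sub>v v + v" using v by (auto simp: algebra_simps)
  then show ?case using step2 add[of "(i - 1) \<cdot>\<^sub>v v" v] v by (simp add: algebra_simps)
qed

lemma additive_vec6:
  fixes \<phi> :: "int vec \<Rightarrow> int"
  assumes add: "\<And>x y. \<lbrakk>x \<in> carrier_vec 6; y \<in> carrier_vec 6\<rbrakk> \<Longrightarrow> \<phi> (x + y) = \<phi> x + \<phi> y"
  shows "\<phi> (vec6 a b c d e f) = a * \<phi> (unit_vec 6 0) + b * \<phi> (unit_vec 6 1) + c * \<phi> (unit_vec 6 2)
    + d * \<phi> (unit_vec 6 3) + e * \<phi> (unit_vec 6 4) + f * \<phi> (unit_vec 6 5)"
proof -
  have "vec6 a b c d e f = a \<cdot>\<^sub>v unit_vec 6 0 + b \<cdot>\<^sub>v unit_vec 6 1 + c \<cdot>\<^sub>v unit_vec 6 2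
    + d \<cdot>\<^sub>v unit_vec 6 3 + e \<cdot>\<^sub>v unit_vec 6 4 + f \<cdot>\<^sub>v unit_vec 6 5"
    by (rule eq_vec_6I) (simp_all add: unit_vec_def)
  then show ?thesis
    by (simp add: add additive_smult_vec[of 6 \<phi>, OF add])
qed

text \<open>Binomial coefficients provide an integral quadratic function with polarization
  \<open>a * b\<close>, which half of a square would not.\<close>

lemma choose_2_add_int:
  fixes a b :: int
  shows "(a + b) * (a + b - 1) div 2 = a * (a - 1) div 2 + b * (b - 1) div 2 + a * b"
proof -
  have "(a + b) * (a + b - 1) = a * (a - 1) + b * (b - 1) + 2 * (a * b)"
    by (simp add: algebra_simps)
  moreover have "2 dvd a * (a - 1)" "2 dvd b * (b - 1)" by simp_all
  ultimately show ?thesis by (simp add: div_plus_div_distrib_dvd_left)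
qed

theorem not_lhs_differential_trivial_the_matrix:
  fixes G :: "'g monoid"
  assumes "group G" and t: "t \<in> carrier G" and G: "carrier G = generate G {t}" "order G = 4"
    and \<rho>: "\<rho> \<in> hom G (AutoGroup (monoid_vec TYPE(int) 6))"
    and \<rho>_t: "\<And>v. v \<in> carrier_vec 6 \<Longrightarrow> \<rho> t v = the_matrix *\<^sub>v v"
  shows "\<not> lhs_differential_trivial (semidirect_product (monoid_vec TYPE(int) 6) G \<rho>)
    (semidirect_kernel (monoid_vec TYPE(int) 6) G) 2"
proof
  assume trivial: "lhs_differential_trivial (semidirect_product (monoid_vec TYPE(int) 6) G \<rho>)
    (semidirect_kernel (monoid_vec TYPE(int) 6) G) 2"
  interpret G: group G by fact
  interpret semidirect "monoid_vec TYPE(int) 6" G \<rho>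
    using comm_group_vec \<open>group G\<close> \<rho> by (simp add: semidirect_def semidirect_axioms_def)
  note [simp] = monoid_vec_simps
  have fin: "finite (carrier G)"
    using G(2) by (simp add: order_def card_ge_0_finite)
  have t_ne: "t \<noteq> \<one>\<^bsub>G\<^esub>"
    using G by (auto simp: order_def G.generate_one)
  have t4: "t [^]\<^bsub>G\<^esub> (4 :: nat) = \<one>\<^bsub>G\<^esub>"
    using G.pow_order_eq_1[OF t] G(2) by simp
  \<comment> \<open>\<open>L\<close> is a sum \<open>M \<oplus> M'\<close> of two lattices of rank 3, and \<open>\<beta>\<close> alternates in its first two arguments
    to the invariant pairing of \<open>\<Lambda>\<^sup>2M\<close> with \<open>M'\<close>.\<close>
  define C :: "int \<Rightarrow> int" where "C a = a * (a - 1) div 2" for a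
  have C: "C (a + b) = C a + C b + a * b" "C 0 = 0" "C 1 = 0" for a b
    by (simp_all only: C_def choose_2_add_int) simp_all
  define \<beta> :: "int vec \<Rightarrow> int vec \<Rightarrow> int vec \<Rightarrow> int" where
    "\<beta> x y z = x $ 0 * y $ 1 * z $ 3 + x $ 0 * y $ 2 * z $ 4 + x $ 1 * y $ 2 * z $ 5" for x y z
  \<comment> \<open>For the given matrix, the pullback of \<beta> along \<open>\<rho> t\<close>
    minus \<beta> is \<open>- (x $ 0 * y $ 1 + x $ 1 * y $ 0) * z $ 3 - x $ 2 * y $ 2 * z $
    4\<close> at \<open>x\<close>, \<open>y\<close>, \<open>z\<close>. The two terms are the
    polarizations of a product of coordinates and of \<open>C\<close>.\<close>
  define q :: "int vec \<Rightarrow> int vec \<Rightarrow> int" where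
    "q x z = - (x $ 0 * x $ 1 * z $ 3) - C (x $ 2) * z $ 4" for x z
  obtain \<omega> where \<omega>: "biadditive (monoid_vec TYPE(int) 6) \<omega>"
    and sum0: "\<And>x y. \<lbrakk>x \<in> carrier_vec 6; y \<in> carrier_vec 6\<rbrakk> \<Longrightarrow>
      (\<Sum>i<(4 :: nat). q (\<rho> (t [^]\<^bsub>G\<^esub> i) x) (\<rho> (t [^]\<^bsub>G\<^esub> i) y)
        - q (\<rho> (t [^]\<^bsub>G\<^esub> i) y) (\<rho> (t [^]\<^bsub>G\<^esub> i) x)
        + \<omega> (\<rho> (t [^]\<^bsub>G\<^esub> i) x) (\<rho> (t [^]\<^bsub>G\<^esub> i) y)) = 0"
  proof (rule norm_of_defect_if_trivial_cyclic[OF trivial fin G(1) t t_ne t4, of \<beta> q])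
    fix x x' y :: "int vec"
    assume "x \<in> carrier (monoid_vec TYPE(int) 6)" "x' \<in> carrier (monoid_vec TYPE(int) 6)"
      "y \<in> carrier (monoid_vec TYPE(int) 6)"
    then have [simp]: "x \<in> carrier_vec 6" "x' \<in> carrier_vec 6" "y \<in> carrier_vec 6" "dim_vec x' = 6"
      by simp_all
    show "q (x \<otimes>\<^bsub>monoid_vec TYPE(int) 6\<^esub> x') y
      = q x y + q x' y + (\<beta> (\<rho> t x) (\<rho> t x') (\<rho> t y) - \<beta> x x' y)"
      by (simp add: q_def \<beta>_def \<rho>_t C algebra_simps)
  next
    fix \<omega> assume "biadditive (monoid_vec TYPE(int) 6) \<omega>"
      and "\<And>x y. \<lbrakk>x \<in> carrier (monoid_vec TYPE(int) 6); y \<in> carrier (monoid_vec TYPE(int) 6)\<rbrakk> \<Longrightarrow>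
      (\<Sum>i<(4 :: nat). q (\<rho> (t [^]\<^bsub>G\<^esub> i) x) (\<rho> (t [^]\<^bsub>G\<^esub> i) y)
        - q (\<rho> (t [^]\<^bsub>G\<^esub> i) y) (\<rho> (t [^]\<^bsub>G\<^esub> i) x)
        + \<omega> (\<rho> (t [^]\<^bsub>G\<^esub> i) x) (\<rho> (t [^]\<^bsub>G\<^esub> i) y)) = 0"
    then show thesis by (intro that[of \<omega>]) simp_all
  qed (simp_all add: \<beta>_def q_def algebra_simps)
  \<comment> \<open>The matrix preserves both summands, so for arguments in M and M' the norm
    involves only these nine values of \<omega>.\<close>
  have expand: "\<omega> (vec6 a b c 0 0 0) (vec6 0 0 0 d e f) =
      a * (d * \<omega> (unit_vec 6 0) (unit_vec 6 3) + e * \<omega> (unit_vec 6 0) (unit_vec 6 4)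
         + f * \<omega> (unit_vec 6 0) (unit_vec 6 5))
    + b * (d * \<omega> (unit_vec 6 1) (unit_vec 6 3) + e * \<omega> (unit_vec 6 1) (unit_vec 6 4)
         + f * \<omega> (unit_vec 6 1) (unit_vec 6 5))
    + c * (d * \<omega> (unit_vec 6 2) (unit_vec 6 3) + e * \<omega> (unit_vec 6 2) (unit_vec 6 4)
         + f * \<omega> (unit_vec 6 2) (unit_vec 6 5))" for a b c d e f
  proof -
    have "\<omega> v (vec6 0 0 0 d e f) = d * \<omega> v (unit_vec 6 3) + e * \<omega> v (unit_vec 6 4) + f * \<omega> v (unit_vec 6 5)"
      if "v \<in> carrier_vec 6" for v
      using \<omega> that by (subst additive_vec6) (simp_all add: biadditive_def)
    then show ?thesis
      using \<omega> by (subst additive_vec6[of "\<lambda>v. \<omega> v (vec6 0 0 0 d e f)"])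
        (simp_all add: biadditive_def algebra_simps)
  qed
  have step: "\<rho> (t [^]\<^bsub>G\<^esub> Suc i) v = the_matrix *\<^sub>v \<rho> (t [^]\<^bsub>G\<^esub> i) v" if "v \<in> carrier_vec 6" for i v
    using t that action_mult[of t "t [^]\<^bsub>G\<^esub> i" v] action_closed[of "t [^]\<^bsub>G\<^esub> i" v]
    by (simp only: G.nat_pow_Suc2[OF t]) (simp add: \<rho>_t)
  have zero: "\<rho> (t [^]\<^bsub>G\<^esub> (0 :: nat)) v = v" if "v \<in> carrier_vec 6" for v
    using that by simp
  have sum4: "(\<Sum>i<(4 :: nat). F i) = F 0 + F (Suc 0) + F (Suc (Suc 0)) + F (Suc (Suc (Suc 0)))"
    for F :: "nat \<Rightarrow> int"
    by (simp add: numeral_eq_Suc)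
  note norm_sum = sum0[unfolded sum4, OF vec6_carrier vec6_carrier,
      unfolded step[OF vec6_carrier] zero[OF vec6_carrier] the_matrix_mult_vec6]
  \<comment> \<open>Twice the first tensor plus the second one has a norm in \<open>M \<otimes> M'\<close> divisible by 4.\<close>
  have "4 * (\<omega> (unit_vec 6 0) (unit_vec 6 3) + \<omega> (unit_vec 6 0) (unit_vec 6 5)
      + \<omega> (unit_vec 6 1) (unit_vec 6 3) - \<omega> (unit_vec 6 1) (unit_vec 6 4)
      + \<omega> (unit_vec 6 1) (unit_vec 6 5) + 2 * \<omega> (unit_vec 6 2) (unit_vec 6 3)
      - \<omega> (unit_vec 6 2) (unit_vec 6 4) + \<omega> (unit_vec 6 2) (unit_vec 6 5)) = 2"
    \<comment> \<open>The first pair is \<open>unit_vec 6 2\<close>, \<open>unit_vec 6 3\<close>: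
      its \<open>q\<close>-terms add up to -1, contributed by the square of \<open>t\<close> alone.
      The second pair is \<open>unit_vec 6 1\<close>, \<open>unit_vec 6 5\<close>, whose
      \<open>q\<close>-terms all vanish. Hence the 2 on the right.\<close>
    using norm_sum[of 0 0 1 0 0 0 0 0 0 1 0 0] norm_sum[of 0 1 0 0 0 0 0 0 0 0 0 1]
    by (simp add: expand q_def C)
  then show False by presburger
qed

section \<open>A counterexample to strong collapse\<close>

lemma fin_gen_free_abelian_vec: "fin_gen_free_abelian (monoid_vec TYPE(int) n)"
proof -
  let ?f = "\<lambda>c. vec n (Poly_Mapping.lookup c) :: int vec"
  have hom: "?f \<in> hom (free_Abelian_group {..<n}) (monoid_vec TYPE(int) n)"
    by (auto simp: hom_def monoid_vec_simps lookup_add)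
  have inj: "inj_on ?f (carrier (free_Abelian_group {..<n}))"
  proof (rule inj_onI)
    fix c d :: "nat \<Rightarrow>\<^sub>0 int"
    assume "c \<in> carrier (free_Abelian_group {..<n})" "d \<in> carrier (free_Abelian_group {..<n})"
      and eq: "?f c = ?f d"
    then have out: "Poly_Mapping.lookup c i = 0" "Poly_Mapping.lookup d i = 0" if "\<not> i < n" for i
      using that by (auto simp: in_keys_iff subset_iff)
    have "Poly_Mapping.lookup c i = Poly_Mapping.lookup d i" if "i < n" for i
      using arg_cong[OF eq, of "\<lambda>v. v $ i"] that by simp
    then show "c = d"
      using out by (metis poly_mapping_eqI)
  qed
  have surj: "v \<in> ?f ` carrier (free_Abelian_group {..<n})" if v: "v \<in> carrier_vec n" for v
  proof -
    define c where "c = Abs_poly_mapping (\<lambda>i. if i < n then v $ i else 0)"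
    have "finite {i. (if i < n then v $ i else 0) \<noteq> 0}"
      by (rule finite_subset[of _ "{..<n}"]) auto
    then have c: "Poly_Mapping.lookup c i = (if i < n then v $ i else 0)" for i
      by (simp add: c_def lookup_Abs_poly_mapping)
    show ?thesis
    proof (rule image_eqI)
      show "v = ?f c" using v by (intro eq_vecI) (auto simp: c)
      show "c \<in> carrier (free_Abelian_group {..<n})"
        by (auto simp: in_keys_iff c split: if_splits)
    qed
  qed
  have "?f \<in> iso (free_Abelian_group {..<n}) (monoid_vec TYPE(int) n)"
    using hom inj surj hom_carrier[OF hom] by (auto simp: iso_def bij_betw_def monoid_vec_simps)
  then have "free_Abelian_group {..<n} \<cong> monoid_vec TYPE(int) n"
    by (auto simp: is_iso_def)
  then have "monoid_vec TYPE(int) n \<cong> free_Abelian_group {..<n}"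
    by (simp add: group.iso_sym)
  then show ?thesis
    unfolding fin_gen_free_abelian_def using comm_group_vec by blast
qed

section \<open>The cyclic group of order n and the action of Z/4 by powers of the matrix\<close>

definition cyclic_nat_group :: "nat \<Rightarrow> nat monoid" where
  "cyclic_nat_group n = \<lparr>carrier = {..<n}, monoid.mult = (\<lambda>a b. (a + b) mod n), one = 0\<rparr>"

lemma group_cyclic_nat_group: "n > 0 \<Longrightarrow> group (cyclic_nat_group n)"
proof (rule groupI)
  fix x assume "n > 0" "x \<in> carrier (cyclic_nat_group n)"
  then show "\<exists>y \<in> carrier (cyclic_nat_group n). y \<otimes>\<^bsub>cyclic_nat_group n\<^esub> x = \<one>\<^bsub>cyclic_nat_group n\<^esub>"
    by (intro bexI[of _ "(n - x) mod n"]) (auto simp: cyclic_nat_group_def mod_simps)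
qed (auto simp: cyclic_nat_group_def mod_simps add.assoc)

lemma pow_cyclic_nat_group: "1 [^]\<^bsub>cyclic_nat_group n\<^esub> (k :: nat) = k mod n"
  by (induction k) (simp_all add: cyclic_nat_group_def mod_simps nat_pow_def)

lemma generate_cyclic_nat_group:
  assumes "n > 1"
  shows "carrier (cyclic_nat_group n) = generate (cyclic_nat_group n) {1}"
proof -
  interpret group "cyclic_nat_group n" using assms by (simp add: group_cyclic_nat_group)
  have "x \<in> {1 [^]\<^bsub>cyclic_nat_group n\<^esub> k | k. k \<in> (UNIV :: nat set)}"
    if "x \<in> carrier (cyclic_nat_group n)" for x
    using that unfolding pow_cyclic_nat_group by (auto simp: cyclic_nat_group_def intro!: exI[of _ x])
  then show ?thesis
    using assms generate_pow_on_finite_carrier[of 1] pow_cyclic_nat_group[of n]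
    by (auto simp: cyclic_nat_group_def)
qed

lemma cyclic_cyclic_nat_group:
  assumes "n > 1"
  shows "cyclic_group (cyclic_nat_group n)"
proof -
  interpret group "cyclic_nat_group n" using assms by (simp add: group_cyclic_nat_group)
  have "1 \<in> carrier (cyclic_nat_group n)" using assms by (simp add: cyclic_nat_group_def)
  then have "carrier (cyclic_nat_group n) = range (\<lambda>k :: int. 1 [^]\<^bsub>cyclic_nat_group n\<^esub> k)"
    using generate_cyclic_nat_group[OF assms] generate_pow[of 1] by auto
  then show ?thesis
    unfolding cyclic_group using \<open>1 \<in> carrier (cyclic_nat_group n)\<close> by blast
qed

text \<open>The restriction to the carrier is there because the elements of \<open>AutoGroup\<close>
  are extensional functions.\<close>

definition matrix_action :: "nat \<Rightarrow> int vec \<Rightarrow> int vec" where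
  "matrix_action k = (\<lambda>v \<in> carrier_vec 6. ((*\<^sub>v) the_matrix ^^ k) v)"

lemma the_matrix_pow_closed: "v \<in> carrier_vec 6 \<Longrightarrow> ((*\<^sub>v) the_matrix ^^ k) v \<in> carrier_vec 6"
  by (induction k) simp_all

lemma the_matrix_pow_4:
  assumes "v \<in> carrier_vec 6"
  shows "((*\<^sub>v) the_matrix ^^ 4) v = v"
proof -
  have "((*\<^sub>v) the_matrix ^^ 4) v = the_matrix *\<^sub>v (the_matrix *\<^sub>v (the_matrix *\<^sub>v (the_matrix *\<^sub>v v)))"
    by (simp add: numeral_eq_Suc)
  also have "\<dots> = v"
    using assms by (intro eq_vec_6I) simp_all
  finally show ?thesis .
qed

lemma the_matrix_pow_mod_4:
  assumes "v \<in> carrier_vec 6"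
  shows "((*\<^sub>v) the_matrix ^^ (k mod 4)) v = ((*\<^sub>v) the_matrix ^^ k) v"
proof -
  have "((*\<^sub>v) the_matrix ^^ (4 * j)) v = v" for j
    by (induction j) (simp_all add: funpow_add the_matrix_pow_4 assms)
  then show ?thesis
    by (metis mod_mult_div_eq comp_apply funpow_add)
qed

lemma the_matrix_pow_add:
  assumes "v \<in> carrier_vec 6" "w \<in> carrier_vec 6"
  shows "((*\<^sub>v) the_matrix ^^ k) (v + w) = ((*\<^sub>v) the_matrix ^^ k) v + ((*\<^sub>v) the_matrix ^^ k) w"
proof (induction k)
  case (Suc k)
  have "the_matrix \<in> carrier_mat 6 6"
    by (rule carrier_matI) (simp_all add: the_matrix_def mat_of_rows_list_def)
  then show ?case
    using Suc assms by (simp add: mult_add_distrib_mat_vec the_matrix_pow_closed)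
qed simp

lemma matrix_action_compose:
  assumes "v \<in> carrier_vec 6"
  shows "matrix_action j (matrix_action k v) = matrix_action ((j + k) mod 4) v"
  using assms by (simp add: matrix_action_def the_matrix_pow_closed the_matrix_pow_mod_4 funpow_add)

lemma matrix_action_auto: "matrix_action k \<in> auto (monoid_vec TYPE(int) 6)"
proof -
  have inv: "matrix_action j (matrix_action k v) = v"
    if "(j + k) mod 4 = 0" "v \<in> carrier_vec 6" for j k v
    using that by (simp add: matrix_action_compose) (simp add: matrix_action_def)
  have "bij_betw (matrix_action k) (carrier_vec 6) (carrier_vec 6)"
  \<comment> \<open>The exponents \<open>k\<close> and \<open>3 * k\<close> add up to a multiple of
    4, the order of the matrix.\<close>
  proof (rule bij_betw_byWitness[where f' = "matrix_action (3 * k)"])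
    show "\<forall>v\<in>carrier_vec 6. matrix_action (3 * k) (matrix_action k v) = v"
      using inv[of "3 * k" k] by simp
    show "\<forall>v\<in>carrier_vec 6. matrix_action k (matrix_action (3 * k) v) = v"
      using inv[of k "3 * k"] by simp
  qed (auto simp: matrix_action_def the_matrix_pow_closed)
  then show ?thesis
    by (auto simp: auto_def hom_def Bij_def monoid_vec_simps matrix_action_def
        the_matrix_pow_closed the_matrix_pow_add)
qed

lemma matrix_action_hom:
  "matrix_action \<in> hom (cyclic_nat_group 4) (AutoGroup (monoid_vec TYPE(int) 6))"
proof (rule homI)
  show "matrix_action k \<in> carrier (AutoGroup (monoid_vec TYPE(int) 6))" for k
    by (simp add: AutoGroup_def matrix_action_auto)
  fix j k
  have "matrix_action ((j + k) mod 4) = compose (carrier_vec 6) (matrix_action j) (matrix_action k)"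
    by (rule extensionalityI[of _ "carrier_vec 6"])
      (auto simp: compose_def matrix_action_compose, auto simp: matrix_action_def)
  then show "matrix_action (j \<otimes>\<^bsub>cyclic_nat_group 4\<^esub> k)
      = matrix_action j \<otimes>\<^bsub>AutoGroup (monoid_vec TYPE(int) 6)\<^esub> matrix_action k"
    using matrix_action_auto
    by (simp add: AutoGroup_def BijGroup_def auto_def monoid_vec_simps cyclic_nat_group_def)
qed

text \<open>Strong collapse includes triviality of the differential for r = 2, which is refuted with
  the residue 1 as the generator \<open>t\<close>.\<close>

lemma not_lhs_collapses_strongly_matrix_action:
  "\<not> lhs_collapses_strongly (semidirect_product (monoid_vec TYPE(int) 6) (cyclic_nat_group 4) matrix_action)
     (semidirect_kernel (monoid_vec TYPE(int) 6) (cyclic_nat_group 4))"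
proof -
  have "\<not> lhs_differential_trivial
     (semidirect_product (monoid_vec TYPE(int) 6) (cyclic_nat_group 4) matrix_action)
     (semidirect_kernel (monoid_vec TYPE(int) 6) (cyclic_nat_group 4)) 2"
  proof (rule not_lhs_differential_trivial_the_matrix)
    show "group (cyclic_nat_group 4)" by (simp add: group_cyclic_nat_group)
    show "carrier (cyclic_nat_group 4) = generate (cyclic_nat_group 4) {1}"
      by (rule generate_cyclic_nat_group) simp
    show "order (cyclic_nat_group 4) = 4" by (simp add: order_def cyclic_nat_group_def)
    show "1 \<in> carrier (cyclic_nat_group 4)" by (simp add: cyclic_nat_group_def)
    show "matrix_action 1 v = the_matrix *\<^sub>v v" if "v \<in> carrier_vec 6" for v
      using that by (simp add: matrix_action_def)
  qed (rule matrix_action_hom)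
  then show ?thesis by (auto simp: lhs_collapses_strongly_def)
qed

theorem theorem0p6:
  shows "(\<forall>(G :: 'g monoid) t \<rho>.
            group G \<and> t \<in> carrier G \<and> carrier G = generate G {t} \<and> order G = 4 \<and>
            \<rho> \<in> hom G (AutoGroup (monoid_vec TYPE(int) 6)) \<and>
            (\<forall>v \<in> carrier_vec 6. \<rho> t v = the_matrix *\<^sub>v v)
            \<longrightarrow> \<not> lhs_differential_trivial
                  (semidirect_product (monoid_vec TYPE(int) 6) G \<rho>)
                  (semidirect_kernel (monoid_vec TYPE(int) 6) G) 2)
       \<and> \<not> (\<forall>(G :: nat monoid) (L :: int vec monoid) \<rho>.
              group G \<and> finite (carrier G) \<and> cyclic_group G \<and> fin_gen_free_abelian L \<and>
              \<rho> \<in> hom G (AutoGroup L)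
              \<longrightarrow> lhs_collapses_strongly (semidirect_product L G \<rho>) (semidirect_kernel L G))"
proof (intro conjI allI impI)
  fix G :: "'g monoid" and t \<rho>
  assume "group G \<and> t \<in> carrier G \<and> carrier G = generate G {t} \<and> order G = 4 \<and>
    \<rho> \<in> hom G (AutoGroup (monoid_vec TYPE(int) 6)) \<and>
    (\<forall>v \<in> carrier_vec 6. \<rho> t v = the_matrix *\<^sub>v v)"
  then show "\<not> lhs_differential_trivial (semidirect_product (monoid_vec TYPE(int) 6) G \<rho>)
    (semidirect_kernel (monoid_vec TYPE(int) 6) G) 2"
    by (intro not_lhs_differential_trivial_the_matrix[of G t]) auto
next
  have "group (cyclic_nat_group 4)" "finite (carrier (cyclic_nat_group 4))"
    "cyclic_group (cyclic_nat_group 4)"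
    by (simp_all add: group_cyclic_nat_group cyclic_cyclic_nat_group)
      (simp add: cyclic_nat_group_def)
  then show "\<not> (\<forall>(G :: nat monoid) (L :: int vec monoid) \<rho>.
    group G \<and> finite (carrier G) \<and> cyclic_group G \<and> fin_gen_free_abelian L \<and>
    \<rho> \<in> hom G (AutoGroup L)
    \<longrightarrow> lhs_collapses_strongly (semidirect_product L G \<rho>) (semidirect_kernel L G))"
    using fin_gen_free_abelian_vec[of 6] matrix_action_hom not_lhs_collapses_strongly_matrix_action
    by blast
qed

end
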